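(* Let $a>0$, $b\in\mathbb{R}$, and $A=1-b^2-4a-2\mathrm{i}b$. The norm $\|\mathrm{e}^{-tM_{a,b}}\|$ admits a complete asymptotic expansion in powers of $t$ as $\langle A\rangle t^2\to0^+$, beginning with $$\|\mathrm{e}^{-tM_{a,b}}\|=1-\frac{a}{12}t^3+\Bigl(\frac1{360}ab^2+\frac1{240}a^2+\frac1{120}a\Bigr)t^5+\frac1{288}a^2t^6+\mathcal{O}(\langle A\rangle^3t^7).$$
   Context: $$M_{a,b}=\begin{pmatrix}1&b&\sqrt a&0\\-b&1&0&\sqrt a\\-\sqrt a&0&0&0\\0&-\sqrt a&0&0\end{pmatrix}.$$ $\|\cdot\|$ is the operator norm on $4\times4$ matrices induced by the Euclidean norm on $\mathbb{C}^4$, and $\langle A\rangle=(1+|A|^2)^{1/2}$. *)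

theory Defs
  imports "HOL-Analysis.Analysis" "HOL-Library.Landau_Symbols"
begin

definition M_ab :: "real \<Rightarrow> real \<Rightarrow> complex^4^4" where
  "M_ab a b = vector
     [vector [1, of_real b, of_real (sqrt a), 0],
      vector [- of_real b, 1, 0, of_real (sqrt a)],
      vector [- of_real (sqrt a), 0, 0, 0],
      vector [0, - of_real (sqrt a), 0, 0]]"

text \<open>The multiplication of the type of square arrays is componentwise and the type carries
  no Banach algebra structure, so the library's \<open>exp\<close> does not apply: the exponential series
  is written out with the matrix product.\<close>

definition mat_pow :: "'a::comm_ring_1^'n^'n \<Rightarrow> nat \<Rightarrow> 'a^'n^'n" where
  "mat_pow X k = (((**) X) ^^ k) (mat 1)"

definition mat_exp :: "complex^'n^'n \<Rightarrow> complex^'n^'n" where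
  "mat_exp X = (\<Sum>k. mat_pow X k /\<^sub>R fact k)"

text \<open>The norm of \<open>complex^'n\<close> is the Euclidean (Hermitian) one, so this is the induced operator
  norm; the \<open>norm\<close> of the array type itself is the Frobenius norm.\<close>

definition op_norm :: "complex^'n^'n \<Rightarrow> real" where
  "op_norm X = onorm ((*v) X)"

definition A_ab :: "real \<Rightarrow> real \<Rightarrow> complex" where
  "A_ab a b = of_real (1 - b\<^sup>2 - 4 * a) - 2 * \<i> * of_real b"

definition bracket :: "complex \<Rightarrow> real" where
  "bracket z = sqrt (1 + (cmod z)\<^sup>2)"

text \<open>The regime \<open>\<langle>A\<rangle>t\<^sup>2 \<rightarrow> 0+\<close> with \<open>a > 0\<close>, \<open>b\<close> real and \<open>t > 0\<close>, as a filter on triples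
  \<open>(a, b, t)\<close>. A Landau bound along it says that there exist \<open>C\<close> and \<open>\<delta> > 0\<close>, not depending on
  \<open>a\<close>, \<open>b\<close> or \<open>t\<close>, such that the bound with constant \<open>C\<close> holds whenever \<open>\<langle>A\<rangle>t\<^sup>2 < \<delta>\<close>.
  Positivity of \<open>t\<close> has to be imposed, since \<open>t\<^sup>2\<close> does not see its sign.\<close>

definition short_time :: "(real \<times> real \<times> real) filter" where
  "short_time =
     inf (filtercomap (\<lambda>(a, b, t). bracket (A_ab a b) * t\<^sup>2) (at_right 0))
         (principal {(a, b, t). a > 0 \<and> t > 0})"

end

theory Submission
  imports Defs "HOL-Complex_Analysis.Complex_Analysis"
begin

text \<open>
  The matrix \<open>M\<^bsub>a,b\<^esub>\<close> is the real form of the complex two by two matrix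
  \<open>m = [[z, \<surd>a], [-\<surd>a, 0]]\<close> with \<open>z = 1 + \<i>b\<close>, where \<open>x + \<i>y\<close> stands for the block
  \<open>[[x, y], [-y, x]]\<close>. This correspondence is multiplicative and preserves operator norms, so it
  suffices to look at the larger singular value of \<open>exp (-t m)\<close>. For a two by two matrix with
  squared Frobenius norm \<open>T\<close> and determinant of modulus \<open>d\<close> the singular values have sum
  \<open>\<surd>(T + 2 d)\<close> and difference \<open>\<surd>(T - 2 d)\<close>, so the larger one is half of
  \<open>\<surd>(T + 2 d) + \<surd>(T - 2 d)\<close> (\<open>op_norm_realify\<close>).

  Since \<open>m - z/2\<close> squares to \<open>s\<^sup>2 = z\<^sup>2/4 - a = cnj A / 4\<close>, the exponential is \<open>exp (-t z/2)\<close> times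
  a combination of \<open>cosh (t s)\<close> and \<open>sinh (t s) / s\<close>. Its determinant has modulus \<open>exp (-t)\<close> and its
  squared Frobenius norm is \<open>exp (-t) F(t)\<close>, where \<open>F(t)\<close> is an even power series
  \<open>\<Sum>\<^sub>k e\<^sub>k t^(2k) / (2k)!\<close> with \<open>e\<^sub>0 = e\<^sub>1 = 2\<close> and
  \<open>e\<^bsub>k+2\<^esub> = Re A e\<^bsub>k+1\<^esub> + b\<^sup>2 e\<^sub>k\<close> (\<open>gram_trace_series\<close>). Hence \<open>F(t) = 2 + t\<^sup>2 G(t)\<close> with
  \<open>G(0) = 1\<close>, and the norm equals
  \<open>h(t) = exp (-t/2) (\<surd>(1 + t\<^sup>2 G(t) / 4) + t/2 \<surd>G(t))\<close>.

  Uniformity in \<open>a\<close> and \<open>b\<close> rests on one scaling: with \<open>L = \<langle>A\<rangle>\<close> one has \<open>b\<^sup>2 \<le> 2 L\<close>, so that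
  \<open>\<bar>e\<^bsub>k+1\<^esub>\<bar> \<le> 2 (3 L)\<^sup>k\<close> (\<open>gram_coeff_bound\<close>). Therefore \<open>G\<close> stays within \<open>1/2\<close> of
  \<open>1\<close> on the complex disc of radius \<open>R = 1 / (6 \<surd>L)\<close>, where \<open>h\<close> is holomorphic and satisfies
  \<open>\<bar>h(z) - 1\<bar> \<le> 8 \<bar>z\<bar>\<close>. That the last bound is linear in \<open>z\<close>, and not merely constant, matters: Cauchy's
  estimates then bound the Taylor remainder after degree \<open>N\<close> by a multiple of
  \<open>t (t/R)\<^sup>N\<close>, which is of order \<open>L^(N/2) t^(N+1)\<close> (\<open>taylor_remainder_le\<close>). For
  \<open>N = 6\<close> this is the remainder \<open>\<langle>A\<rangle>\<^sup>3 t\<^sup>7\<close>. The first seven coefficients follow by squaring: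
  the two square roots are the power series with constant term \<open>1\<close> whose squares are
  \<open>1 + t\<^sup>2 G / 4\<close> and \<open>G\<close>.
\<close>

section \<open>Complex two by two matrices as real four by four matrices\<close>

text \<open>The dollar sign denotes vector components throughout.\<close>

unbundle no fps_syntax

lemma vector_4:
  "(vector [w, x, y, z] :: 'a::zero^4) $ 1 = w"
  "(vector [w, x, y, z] :: 'a::zero^4) $ 2 = x"
  "(vector [w, x, y, z] :: 'a::zero^4) $ 3 = y"
  "(vector [w, x, y, z] :: 'a::zero^4) $ 4 = z"
  by (simp_all add: vector_def)

text \<open>The ring homomorphism from complex two by two matrices \<open>[[p, q], [r, s]]\<close> that replaces each
  entry \<open>x + \<i>y\<close> by the real block \<open>[[x, y], [-y, x]]\<close>.\<close>

definition realify :: "complex \<Rightarrow> complex \<Rightarrow> complex \<Rightarrow> complex \<Rightarrow> complex^4^4" where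
  "realify p q r s = vector
     [vector [of_real (Re p), of_real (Im p), of_real (Re q), of_real (Im q)],
      vector [- of_real (Im p), of_real (Re p), - of_real (Im q), of_real (Re q)],
      vector [of_real (Re r), of_real (Im r), of_real (Re s), of_real (Im s)],
      vector [- of_real (Im r), of_real (Re r), - of_real (Im s), of_real (Re s)]]"

lemma realify_mult:
  "realify p q r s ** realify p' q' r' s' =
     realify (p * p' + q * r') (p * q' + q * s') (r * p' + s * r') (r * q' + s * s')"
  by (simp add: vec_eq_iff forall_4 matrix_matrix_mult_def sum_4 realify_def vector_4 algebra_simps)

lemma realify_1: "realify 1 0 0 1 = mat 1"
  by (simp add: vec_eq_iff forall_4 realify_def vector_4 mat_def)

lemma realify_scaleR:
  "c *\<^sub>R realify p q r s = realify (c *\<^sub>R p) (c *\<^sub>R q) (c *\<^sub>R r) (c *\<^sub>R s)"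
  by (simp add: vec_eq_iff forall_4 realify_def vector_4 scaleR_conv_of_real[where 'a = complex])

lemma M_ab_realify: "M_ab a b = realify (Complex 1 b) (of_real (sqrt a)) (- of_real (sqrt a)) 0"
  by (simp add: vec_eq_iff forall_4 realify_def vector_4 M_ab_def)

lemma realify_sums:
  assumes "p sums P" "q sums Q" "r sums R" "s sums S"
  shows "(\<lambda>k. realify (p k) (q k) (r k) (s k)) sums realify P Q R S"
proof -
  note S = assms[THEN sums_Re] assms[THEN sums_Im]
  note T = S[THEN sums_of_real[where ?'a = complex]]
  note U = T T[THEN sums_minus]
  have "(\<lambda>k. realify (p k) (q k) (r k) (s k) $ i $ j) sums (realify P Q R S $ i $ j)" for i j
    using exhaust_4[of i] exhaust_4[of j] U
    by (elim disjE; simp add: realify_def vector_4)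
  then show ?thesis
    by (auto simp: sums_def intro!: vec_tendstoI)
qed

lemma mat_pow_0: "mat_pow X 0 = mat 1"
  and mat_pow_Suc: "mat_pow X (Suc k) = X ** mat_pow X k"
  by (simp_all add: mat_pow_def)

lemma mat_pow_scaleR:
  fixes X :: "complex^'n^'n"
  shows "mat_pow (c *\<^sub>R X) k = c ^ k *\<^sub>R mat_pow X k"
  by (induction k)
    (simp_all add: mat_pow_0 mat_pow_Suc vec_eq_iff matrix_matrix_mult_def scaleR_sum_right mult_ac)

section \<open>The matrix exponential\<close>

text \<open>The Lucas sequence of the polynomial \<open>X\<^sup>2 - z X + w\<close>. If this is the characteristic polynomial of a
  two by two matrix \<open>m\<close>, then \<open>m\<^bsup>k+1\<^esup> = u\<^bsub>k+1\<^esub> m - w u\<^sub>k\<close>, which reduces the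
  exponential series of \<open>m\<close> to scalar series.\<close>

fun lucas :: "complex \<Rightarrow> complex \<Rightarrow> nat \<Rightarrow> complex" where
  "lucas z w 0 = 0"
| "lucas z w (Suc 0) = 1"
| "lucas z w (Suc (Suc k)) = z * lucas z w (Suc k) - w * lucas z w k"

lemma mat_pow_M_ab:
  fixes a b :: real
  assumes "a > 0"
  defines "z \<equiv> Complex 1 b"
  defines "u \<equiv> lucas z (of_real a)"
  shows "mat_pow (M_ab a b) k =
    realify (u (Suc k)) (of_real (sqrt a) * u k) (- of_real (sqrt a) * u k) (u (Suc k) - z * u k)"
proof (induction k)
  case 0
  show ?case by (simp add: mat_pow_0 realify_1 u_def)
next
  case (Suc k)
  have "complex_of_real (sqrt a) * of_real (sqrt a) = of_real a"
    using assms(1) by (simp flip: of_real_mult)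
  then have *: "complex_of_real (sqrt a) * (of_real (sqrt a) * x) = of_real a * x" for x
    by (simp flip: mult.assoc)
  show ?case
    unfolding mat_pow_Suc Suc unfolding M_ab_realify realify_mult u_def z_def[symmetric]
    by (simp add: * algebra_simps)
qed

text \<open>The value at \<open>s = 0\<close> is the limit; it occurs when \<open>A = 0\<close>, that is for \<open>a = 1/4\<close> and \<open>b = 0\<close>,
  where the two eigenvalues of \<open>m\<close> coincide.\<close>

definition sinhc :: "real \<Rightarrow> complex \<Rightarrow> complex" where
  "sinhc t s = (if s = 0 then of_real t else sinh (of_real t * s) / s)"

lemma exp_add_diff_cosh_sinh:
  fixes x s :: complex
  shows "exp (x + s) = exp x * (cosh s + sinh s)" "exp (x - s) = exp x * (cosh s - sinh s)"
  by (simp_all add: cosh_plus_sinh cosh_minus_sinh flip: exp_add)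

text \<open>The roots of \<open>X\<^sup>2 - z X + w\<close> are \<open>z/2 \<plusminus> s\<close>.\<close>

lemma lucas_closed:
  assumes "z\<^sup>2 = 4 * (s\<^sup>2 + w)"
  shows "s \<noteq> 0 \<Longrightarrow> lucas z w k = ((z/2 + s) ^ k - (z/2 - s) ^ k) / (2 * s)"
    and "s = 0 \<Longrightarrow> lucas z w k = of_nat k * (z/2) ^ (k - 1)"
proof -
  have w: "w = (z/2 + s) * (z/2 - s)"
    using assms by (simp add: algebra_simps power2_eq_square)
  show "lucas z w k = ((z/2 + s) ^ k - (z/2 - s) ^ k) / (2 * s)" if s: "s \<noteq> 0"
  proof (induction k rule: induct_nat_012)
    case (ge2 n)
    have z: "z = (z/2 + s) + (z/2 - s)" by simp
    have *: "(x + y) * (x * x^n - y * y^n) - x * y * (x^n - y^n) = x * (x * x^n) - y * (y * y ^n)" for x y :: complex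
      by (simp add: algebra_simps)
    have "lucas z w (Suc (Suc n)) * (2 * s) = z * (lucas z w (Suc n) * (2 * s)) - w * (lucas z w n * (2 * s))"
      by (simp add: algebra_simps)
    also have "\<dots> = z * ((z/2 + s) ^ Suc n - (z/2 - s) ^ Suc n) - w * ((z/2 + s) ^ n - (z/2 - s) ^ n)"
      using s ge2 by simp
    also have "\<dots> = (z/2 + s) ^ Suc (Suc n) - (z/2 - s) ^ Suc (Suc n)"
      using *[of "z/2+s" "z/2-s"] w z by simp
    finally show ?case using s by (simp add: nonzero_eq_divide_eq)
  qed (use s in auto)
  show "lucas z w k = of_nat k * (z/2) ^ (k - 1)" if s: "s = 0"
  proof (induction k rule: induct_nat_012)
    case (ge2 n)
    define y where "y = z / 2"
    have y: "z = 2 * y" "w = y * y" using w s by (simp_all add: y_def)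
    have "lucas z w (Suc (Suc n)) = 2 * y * (of_nat (Suc n) * y ^ n) - y * y * (of_nat n * y ^ (n - 1))"
      using ge2 by (simp add: y)
    also have "\<dots> = of_nat (Suc (Suc n)) * y ^ Suc n"
      by (cases n) (simp_all add: algebra_simps)
    finally show ?case by (simp add: y_def)
  qed auto
qed

text \<open>The two scalar series from which all entries of \<open>exp (-t m)\<close> are built, summed by inserting the
  closed form of the Lucas sequence and using the exponential series at both roots.\<close>

lemma lucas_exp_series:
  fixes t :: real and s w z :: complex
  assumes "z\<^sup>2 = 4 * (s\<^sup>2 + w)"
  defines "E \<equiv> exp (- (of_real t * z / 2))"
  shows "(\<lambda>k. ((- t) ^ k *\<^sub>R lucas z w k) /\<^sub>R fact k) sums (- E * sinhc t s)" (is "?U sums _")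
    and "(\<lambda>k. ((- t) ^ k *\<^sub>R lucas z w (Suc k)) /\<^sub>R fact k) sums
           (E * (cosh (of_real t * s) - z / 2 * sinhc t s))" (is "?V sums _")
proof -
  define x y where "x = z/2 + s" and "y = z/2 - s"
  have ex: "(\<lambda>k. ((- t) ^ k *\<^sub>R v ^ k) /\<^sub>R fact k) sums exp (- (of_real t * v))" for v :: complex
    using exp_converges[of "of_real (- t) * v"]
    unfolding power_mult_distrib of_real_power[symmetric] scaleR_conv_of_real by simp
  have Ex: "exp (- (of_real t * x)) = E * (cosh (of_real t * s) - sinh (of_real t * s))"
    and Ey: "exp (- (of_real t * y)) = E * (cosh (of_real t * s) + sinh (of_real t * s))"
    unfolding E_def exp_add_diff_cosh_sinh[symmetric] x_def y_def
    by (auto intro!: arg_cong[where f = exp] simp: algebra_simps)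
  show "?U sums (- E * sinhc t s)"
  proof (cases "s = 0")
    case False
    have "?U = (\<lambda>k. (((- t) ^ k *\<^sub>R x ^ k) /\<^sub>R fact k - ((- t) ^ k *\<^sub>R y ^ k) /\<^sub>R fact k) / (2 * s))"
      unfolding lucas_closed(1)[OF assms(1) False] x_def[symmetric] y_def[symmetric]
      using False by (simp add: fun_eq_iff scaleR_conv_of_real field_simps)
    moreover have "\<dots> sums ((exp (- (of_real t * x)) - exp (- (of_real t * y))) / (2 * s))"
      by (intro sums_divide sums_diff ex)
    moreover have "(exp (- (of_real t * x)) - exp (- (of_real t * y))) / (2 * s) = - E * sinhc t s"
      using False unfolding Ex Ey by (simp add: sinhc_def field_simps)
    ultimately show ?thesis by simp
  next
    case True
    have "(\<lambda>k. ((- t) ^ Suc k *\<^sub>R lucas z w (Suc k)) /\<^sub>R fact (Suc k)) =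
      (\<lambda>k. - of_real t * (((- t) ^ k *\<^sub>R (z/2) ^ k) /\<^sub>R fact k))"
      unfolding lucas_closed(2)[OF assms(1) True]
      by (auto simp add: fun_eq_iff scaleR_conv_of_real field_simps simp del: of_nat_Suc)
    moreover have "\<dots> sums (- of_real t * exp (- (of_real t * (z/2))))"
      by (intro sums_mult ex)
    ultimately have "?U sums (- of_real t * exp (- (of_real t * (z/2))) + ?U 0)"
      by (intro iffD1[OF sums_Suc_iff]) simp
    then show ?thesis using True by (simp add: sinhc_def E_def mult.commute)
  qed
  show "?V sums (E * (cosh (of_real t * s) - z / 2 * sinhc t s))"
  proof (cases "s = 0")
    case False
    have "?V = (\<lambda>k. (x * (((- t) ^ k *\<^sub>R x ^ k) /\<^sub>R fact k) - y * (((- t) ^ k *\<^sub>R y ^ k) /\<^sub>R fact k)) / (2 * s))"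
      unfolding lucas_closed(1)[OF assms(1) False] x_def[symmetric] y_def[symmetric]
      using False by (simp add: fun_eq_iff scaleR_conv_of_real field_simps)
    moreover have "\<dots> sums ((x * exp (- (of_real t * x)) - y * exp (- (of_real t * y))) / (2 * s))"
      by (intro sums_divide sums_diff sums_mult ex)
    moreover have "(x * exp (- (of_real t * x)) - y * exp (- (of_real t * y))) / (2 * s) =
       (E * (cosh (of_real t * s) - z / 2 * sinhc t s))"
      using False unfolding Ex Ey unfolding x_def y_def by (simp add: sinhc_def field_simps)
    ultimately show ?thesis by simp
  next
    case True
    have "?V = (\<lambda>k. ((- t) ^ k *\<^sub>R (z/2) ^ k) /\<^sub>R fact k + z/2 * ?U k)"
    proof
      fix k
      have "of_nat (Suc k) * y ^ k = y ^ k + y * (of_nat k * y ^ (k - 1))" for y :: complex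
        by (cases k) (simp_all add: algebra_simps)
      then show "?V k = ((- t) ^ k *\<^sub>R (z/2) ^ k) /\<^sub>R fact k + z/2 * ?U k"
        unfolding lucas_closed(2)[OF assms(1) True]
        by (simp only: diff_Suc_1 scaleR_add_right mult_scaleR_right)
    qed
    moreover have "\<dots> sums (exp (- (of_real t * (z/2))) + z/2 * (- E * sinhc t s))"
      by (intro sums_add sums_mult ex) fact
    ultimately show ?thesis using True by (simp add: E_def algebra_simps)
  qed
qed

section \<open>The operator norm of a realified matrix\<close>

text \<open>The Hermitian form of the Gram matrix \<open>[[A, e], [cnj e, C]]\<close> of a two by two matrix; the
  following lemma computes its determinant.\<close>

lemma gram_expand:
  fixes p q r s u v :: complex
  shows "(cmod (p * u + q * v))\<^sup>2 + (cmod (r * u + s * v))\<^sup>2 =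
    ((cmod p)\<^sup>2 + (cmod r)\<^sup>2) * (cmod u)\<^sup>2 + ((cmod q)\<^sup>2 + (cmod s)\<^sup>2) * (cmod v)\<^sup>2
      + 2 * Re (cnj u * (cnj p * q + cnj r * s) * v)"
  unfolding cmod_power2 by (simp add: algebra_simps power2_eq_square)

lemma gram_det:
  fixes p q r s :: complex
  shows "((cmod p)\<^sup>2 + (cmod r)\<^sup>2) * ((cmod q)\<^sup>2 + (cmod s)\<^sup>2) - (cmod (cnj p * q + cnj r * s))\<^sup>2
     = (cmod (p * s - q * r))\<^sup>2"
  unfolding cmod_power2 by (simp add: algebra_simps power2_eq_square)

text \<open>With \<open>\<mu>\<close> an eigenvalue above both diagonal entries, the difference of the two sides dominates
  the square of \<open>\<surd>(\<mu> - A) \<bar>u\<bar> - \<surd>(\<mu> - C) \<bar>v\<bar>\<close>, because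
  \<open>\<surd>(\<mu> - A) \<surd>(\<mu> - C) = \<bar>e\<bar>\<close>.\<close>

lemma hermitian_form_le:
  fixes A C \<mu> :: real and e u v :: complex
  assumes "A \<le> \<mu>" "C \<le> \<mu>" and char: "(\<mu> - A) * (\<mu> - C) = (cmod e)\<^sup>2"
  shows "A * (cmod u)\<^sup>2 + C * (cmod v)\<^sup>2 + 2 * Re (cnj u * e * v) \<le> \<mu> * ((cmod u)\<^sup>2 + (cmod v)\<^sup>2)"
proof -
  define x y where "x = sqrt (\<mu> - A)" and "y = sqrt (\<mu> - C)"
  have x: "x\<^sup>2 = \<mu> - A" and y: "y\<^sup>2 = \<mu> - C" using assms by (simp_all add: x_def y_def)
  have "x * y = sqrt ((cmod e)\<^sup>2)"
    unfolding x_def y_def char[symmetric] by (simp add: real_sqrt_mult)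
  then have e: "cmod e = x * y" by simp
  have "Re (cnj u * e * v) \<le> cmod (cnj u * e * v)" by (rule complex_Re_le_cmod)
  also have "\<dots> = cmod u * (x * y) * cmod v" by (simp add: norm_mult e)
  also have "\<dots> = (x * cmod u) * (y * cmod v)" by simp
  finally have "2 * Re (cnj u * e * v) \<le> 2 * (x * cmod u) * (y * cmod v)" by linarith
  also have "\<dots> \<le> (x * cmod u)\<^sup>2 + (y * cmod v)\<^sup>2" by (rule sum_squares_bound)
  finally show ?thesis by (simp add: power_mult_distrib x y algebra_simps)
qed

text \<open>The vector \<open>(e, \<mu> - A)\<close> is an eigenvector for \<open>\<mu>\<close> unless it vanishes, in which case
  \<open>(1, 0)\<close> is one.\<close>

lemma hermitian_form_attained:
  fixes A C \<mu> :: real and e :: complex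
  assumes char: "(\<mu> - A) * (\<mu> - C) = (cmod e)\<^sup>2"
  shows "\<exists>u v. (u \<noteq> 0 \<or> v \<noteq> 0) \<and>
    A * (cmod u)\<^sup>2 + C * (cmod v)\<^sup>2 + 2 * Re (cnj u * e * v) = \<mu> * ((cmod u)\<^sup>2 + (cmod v)\<^sup>2)"
proof (cases "e = 0 \<and> \<mu> = A")
  case True
  then show ?thesis by (intro exI[of _ 1] exI[of _ 0]) simp
next
  case False
  have "cnj e * e * of_real (\<mu> - A) = of_real ((cmod e)\<^sup>2 * (\<mu> - A))"
    by (simp add: complex_norm_square mult.commute del: of_real_power)
  then have re: "Re (cnj e * e * of_real (\<mu> - A)) = (cmod e)\<^sup>2 * (\<mu> - A)"
    by (simp only: Re_complex_of_real)
  have "A * E + C * X\<^sup>2 + 2 * (E * X) = \<mu> * (E + X\<^sup>2)"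
    if "X = \<mu> - A" "X * (\<mu> - C) = E" for X E
    unfolding that(2)[symmetric] that(1) by (simp add: algebra_simps power2_eq_square)
  from this[OF refl char]
  have "A * (cmod e)\<^sup>2 + C * (cmod (of_real (\<mu> - A)))\<^sup>2 + 2 * Re (cnj e * e * of_real (\<mu> - A)) =
      \<mu> * ((cmod e)\<^sup>2 + (cmod (of_real (\<mu> - A)))\<^sup>2)"
    unfolding re norm_of_real power2_abs .
  moreover have "e \<noteq> 0 \<or> complex_of_real (\<mu> - A) \<noteq> 0" using False by simp
  ultimately show ?thesis by blast
qed

text \<open>The larger singular value of a two by two matrix, in terms of its squared Frobenius norm \<open>T\<close>
  and the modulus \<open>d\<close> of its determinant.\<close>

definition sing_max :: "real \<Rightarrow> real \<Rightarrow> real" where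
  "sing_max T d = (sqrt (T + 2 * d) + sqrt (T - 2 * d)) / 2"

text \<open>Here \<open>A\<close>, \<open>C\<close> and \<open>E = \<bar>e\<bar>\<^sup>2\<close> are the data of a Gram matrix of determinant \<open>d\<^sup>2\<close>. The square of the
  claimed singular value is \<open>(A + C + \<surd>((A - C)\<^sup>2 + 4 E)) / 2\<close>, the larger root of the
  characteristic polynomial.\<close>

lemma sing_max_char:
  fixes A C d E :: real
  assumes "A * C - E = d\<^sup>2" "A \<ge> 0" "C \<ge> 0" "E \<ge> 0" "d \<ge> 0"
  defines "\<mu> \<equiv> (sing_max (A + C) d)\<^sup>2"
  shows "2 * d \<le> A + C" "A \<le> \<mu>" "C \<le> \<mu>" "(\<mu> - A) * (\<mu> - C) = E"
proof -
  have disc: "(A + C)\<^sup>2 - (2 * d)\<^sup>2 = (A - C)\<^sup>2 + 4 * E"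
    using assms(1) by (simp add: power2_eq_square algebra_simps)
  then have "(2 * d)\<^sup>2 \<le> (A + C)\<^sup>2" using \<open>E \<ge> 0\<close> by (smt (verit) zero_le_power2)
  then show T: "2 * d \<le> A + C" using power2_le_imp_le[of "2 * d" "A + C"] assms(2,3) by simp
  define S where "S = sqrt ((A - C)\<^sup>2 + 4 * E)"
  have S2: "S\<^sup>2 = (A - C)\<^sup>2 + 4 * E" using \<open>E \<ge> 0\<close> by (simp add: S_def)
  have "sqrt (A + C + 2 * d) * sqrt (A + C - 2 * d) = S"
    unfolding S_def disc[symmetric] real_sqrt_mult[symmetric] by (simp add: power2_eq_square algebra_simps)
  then have lam: "\<mu> = (A + C + S) / 2"
    using T \<open>d \<ge> 0\<close> unfolding \<mu>_def sing_max_def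
    by (simp add: power_divide power2_sum mult.assoc)
  have "\<bar>A - C\<bar> \<le> S" unfolding S_def using \<open>E \<ge> 0\<close> by (intro real_le_rsqrt) simp
  then show "A \<le> \<mu>" "C \<le> \<mu>" by (auto simp: lam)
  have "(\<mu> - A) * (\<mu> - C) = (S\<^sup>2 - (A - C)\<^sup>2) / 4"
    unfolding lam by (simp add: power2_eq_square field_simps)
  then show "(\<mu> - A) * (\<mu> - C) = E" by (simp add: S2)
qed

lemma norm_vec4: "(norm (x :: complex^4))\<^sup>2 = (cmod (x$1))\<^sup>2 + (cmod (x$2))\<^sup>2 + (cmod (x$3))\<^sup>2 + (cmod (x$4))\<^sup>2"
  by (simp add: norm_vec_def L2_set_def sum_4 sum_nonneg)

lemma cmod_split: "(cmod x)\<^sup>2 + (cmod y)\<^sup>2 = ((cmod (x - \<i> * y))\<^sup>2 + (cmod (cnj (x + \<i> * y)))\<^sup>2) / 2"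
  unfolding cmod_power2 by (simp add: algebra_simps power2_eq_square)

text \<open>The vectors \<open>(1, \<i>)\<close> and \<open>(1, -\<i>)\<close> are common eigenvectors of all blocks
  \<open>[[x, y], [-y, x]]\<close>, with eigenvalues \<open>x + \<i>y\<close> and \<open>x - \<i>y\<close>. In the corresponding orthogonal
  decomposition of \<open>\<complex>\<^sup>4\<close> the matrix acts as the given two by two matrix on one half and as its
  entrywise conjugate on the other; conjugating the second half makes both act alike.\<close>

lemma norm_realify:
  fixes p q r s :: complex and x :: "complex^4"
  defines "N \<equiv> \<lambda>u v. (cmod (p * u + q * v))\<^sup>2 + (cmod (r * u + s * v))\<^sup>2"
  shows "(norm (realify p q r s *v x))\<^sup>2 =
     (N (x$1 - \<i> * x$2) (x$3 - \<i> * x$4) + N (cnj (x$1 + \<i> * x$2)) (cnj (x$3 + \<i> * x$4))) / 2"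
proof -
  define y where "y = realify p q r s *v x"
  have y: "y$1 - \<i> * y$2 = p * (x$1 - \<i> * x$2) + q * (x$3 - \<i> * x$4)"
    "y$3 - \<i> * y$4 = r * (x$1 - \<i> * x$2) + s * (x$3 - \<i> * x$4)"
    "cnj (y$1 + \<i> * y$2) = p * cnj (x$1 + \<i> * x$2) + q * cnj (x$3 + \<i> * x$4)"
    "cnj (y$3 + \<i> * y$4) = r * cnj (x$1 + \<i> * x$2) + s * cnj (x$3 + \<i> * x$4)"
    by (simp_all add: y_def matrix_vector_mult_def sum_4 realify_def vector_4 complex_eq_iff algebra_simps)
  have "(norm y)\<^sup>2 = ((cmod (y$1))\<^sup>2 + (cmod (y$2))\<^sup>2) + ((cmod (y$3))\<^sup>2 + (cmod (y$4))\<^sup>2)"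
    by (simp add: norm_vec4)
  also have "\<dots> = (N (x$1 - \<i> * x$2) (x$3 - \<i> * x$4) + N (cnj (x$1 + \<i> * x$2)) (cnj (x$3 + \<i> * x$4))) / 2"
    unfolding cmod_split[of "y$1" "y$2"] cmod_split[of "y$3" "y$4"] y N_def by (simp add: field_simps)
  finally show ?thesis by (simp add: y_def)
qed

text \<open>The upper bound holds on both halves of the decomposition; it is attained at a vector of the
  first half whose coordinates form a top eigenvector of the Gram matrix.\<close>

lemma op_norm_realify:
  "op_norm (realify p q r s) =
    sing_max ((cmod p)\<^sup>2 + (cmod q)\<^sup>2 + (cmod r)\<^sup>2 + (cmod s)\<^sup>2) (cmod (p * s - q * r))"
proof -
  define A C e d where "A = (cmod p)\<^sup>2 + (cmod r)\<^sup>2" and "C = (cmod q)\<^sup>2 + (cmod s)\<^sup>2"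
    and "e = cnj p * q + cnj r * s" and "d = cmod (p * s - q * r)"
  define m where "m = sing_max (A + C) d"
  have det: "A * C - (cmod e)\<^sup>2 = d\<^sup>2" unfolding A_def C_def e_def d_def by (rule gram_det)
  have nonneg: "A \<ge> 0" "C \<ge> 0" "(cmod e)\<^sup>2 \<ge> 0" "d \<ge> 0" by (simp_all add: A_def C_def d_def)
  note ch = sing_max_char[OF det nonneg, folded m_def]
  have m0: "m \<ge> 0" using ch(1) nonneg unfolding m_def sing_max_def by simp
  define N where "N u v = (cmod (p * u + q * v))\<^sup>2 + (cmod (r * u + s * v))\<^sup>2" for u v
  have N: "N u v = A * (cmod u)\<^sup>2 + C * (cmod v)\<^sup>2 + 2 * Re (cnj u * e * v)" for u v
    unfolding N_def A_def C_def e_def by (rule gram_expand)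
  have le: "N u v \<le> m\<^sup>2 * ((cmod u)\<^sup>2 + (cmod v)\<^sup>2)" for u v
    unfolding N by (rule hermitian_form_le) (use ch in auto)
  have nr: "(norm (realify p q r s *v x))\<^sup>2 =
     (N (x$1 - \<i> * x$2) (x$3 - \<i> * x$4) + N (cnj (x$1 + \<i> * x$2)) (cnj (x$3 + \<i> * x$4))) / 2" for x
    unfolding N_def by (rule norm_realify)
  have nx: "(norm x)\<^sup>2 = (((cmod (x$1 - \<i> * x$2))\<^sup>2 + (cmod (x$3 - \<i> * x$4))\<^sup>2) +
      ((cmod (cnj (x$1 + \<i> * x$2)))\<^sup>2 + (cmod (cnj (x$3 + \<i> * x$4)))\<^sup>2)) / 2" for x :: "complex^4"
    using cmod_split[of "x$1" "x$2"] cmod_split[of "x$3" "x$4"] unfolding norm_vec4 by simp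
  have upper: "norm (realify p q r s *v x) \<le> m * norm x" for x
  proof (rule power2_le_imp_le)
    show "(norm (realify p q r s *v x))\<^sup>2 \<le> (m * norm x)\<^sup>2"
      using le[of "x$1 - \<i> * x$2" "x$3 - \<i> * x$4"] le[of "cnj (x$1 + \<i> * x$2)" "cnj (x$3 + \<i> * x$4)"]
      unfolding power_mult_distrib nr nx[of x] by (simp add: algebra_simps del: complex_mod_cnj complex_cnj_add)
  qed (use m0 in simp)
  obtain u v where uv: "u \<noteq> 0 \<or> v \<noteq> 0" and attained: "N u v = m\<^sup>2 * ((cmod u)\<^sup>2 + (cmod v)\<^sup>2)"
    using hermitian_form_attained[OF ch(4)] unfolding N by blast
  define x :: "complex^4" where "x = vector [u, \<i> * u, v, \<i> * v]"
  have x: "x$1 = u" "x$2 = \<i> * u" "x$3 = v" "x$4 = \<i> * v"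
    by (simp_all add: x_def vector_4)
  have i: "w - \<i> * (\<i> * w) = 2 * w" "cnj (w + \<i> * (\<i> * w)) = 0" for w
    by (simp_all flip: mult.assoc)
  have N0: "N 0 0 = 0" by (simp add: N_def)
  have N2: "N (2 * u) (2 * v) = 4 * N u v"
  proof -
    have two: "p * (2 * u) + q * (2 * v) = 2 * (p * u + q * v)" "r * (2 * u) + s * (2 * v) = 2 * (r * u + s * v)"
      by (simp_all add: algebra_simps)
    show ?thesis unfolding N_def two norm_mult power_mult_distrib by simp
  qed
  have "(norm (realify p q r s *v x))\<^sup>2 = (m * norm x)\<^sup>2"
    unfolding power_mult_distrib nr nx[of x] x i
    by (simp add: N0 N2 attained norm_mult power_mult_distrib)
  then have "norm (realify p q r s *v x) = m * norm x"
    using m0 by (simp add: power2_eq_iff_nonneg)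
  moreover have "x \<noteq> 0" using uv by (auto simp: x_def vec_eq_iff forall_4 vector_4)
  ultimately have "m \<le> onorm ((*v) (realify p q r s))"
    using le_onorm[OF matrix_vector_mul_bounded_linear, of "realify p q r s" x] by simp
  moreover have "onorm ((*v) (realify p q r s)) \<le> m"
    using upper by (rule onorm_le)
  ultimately have "op_norm (realify p q r s) = m" by (simp add: op_norm_def)
  then show ?thesis by (simp add: m_def A_def C_def d_def add_ac)
qed

section \<open>The norm of the exponential as a scalar function\<close>

lemma mat_exp_M_ab:
  fixes a b t :: real and s :: complex
  assumes "a > 0" and s: "(Complex 1 b)\<^sup>2 = 4 * (s\<^sup>2 + of_real a)"
  defines "E \<equiv> exp (- (of_real t * Complex 1 b / 2))"
    and "c \<equiv> cosh (of_real t * s)" and "d \<equiv> sinhc t s"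
  shows "mat_exp ((- t) *\<^sub>R M_ab a b) =
    realify (E * (c - Complex 1 b / 2 * d)) (- of_real (sqrt a) * E * d)
      (of_real (sqrt a) * E * d) (E * (c + Complex 1 b / 2 * d))"
proof -
  define z where "z = Complex 1 b"
  define u where "u = lucas z (of_real a)"
  note U = lucas_exp_series(1)[OF s, of t, folded E_def d_def z_def, folded u_def]
  note V = lucas_exp_series(2)[OF s, of t, folded E_def c_def d_def z_def, folded u_def]
  have "mat_pow ((- t) *\<^sub>R M_ab a b) k /\<^sub>R fact k =
      realify (((- t) ^ k *\<^sub>R u (Suc k)) /\<^sub>R fact k) (of_real (sqrt a) * (((- t) ^ k *\<^sub>R u k) /\<^sub>R fact k))
        (- of_real (sqrt a) * (((- t) ^ k *\<^sub>R u k) /\<^sub>R fact k))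
        (((- t) ^ k *\<^sub>R u (Suc k)) /\<^sub>R fact k - z * (((- t) ^ k *\<^sub>R u k) /\<^sub>R fact k))" for k
    unfolding mat_pow_scaleR mat_pow_M_ab[OF \<open>a > 0\<close>] realify_scaleR u_def z_def
    by (simp only: mult_scaleR_right scaleR_diff_right)
  moreover have "(\<lambda>k. realify (((- t) ^ k *\<^sub>R u (Suc k)) /\<^sub>R fact k) (of_real (sqrt a) * (((- t) ^ k *\<^sub>R u k) /\<^sub>R fact k))
        (- of_real (sqrt a) * (((- t) ^ k *\<^sub>R u k) /\<^sub>R fact k))
        (((- t) ^ k *\<^sub>R u (Suc k)) /\<^sub>R fact k - z * (((- t) ^ k *\<^sub>R u k) /\<^sub>R fact k))) sums
      realify (E * (c - z / 2 * d)) (of_real (sqrt a) * (- E * d)) (- of_real (sqrt a) * (- E * d))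
        (E * (c - z / 2 * d) - z * (- E * d))"
    by (intro realify_sums sums_diff sums_mult U V)
  ultimately have "mat_exp ((- t) *\<^sub>R M_ab a b) =
      realify (E * (c - z / 2 * d)) (of_real (sqrt a) * (- E * d)) (- of_real (sqrt a) * (- E * d))
        (E * (c - z / 2 * d) - z * (- E * d))"
    unfolding mat_exp_def by (simp only: sums_iff)
  also have "E * (c - z / 2 * d) - z * (- E * d) = E * (c + z / 2 * d)" by (simp add: field_simps)
  finally show ?thesis by (simp add: z_def mult_ac)
qed

lemma cosh_sq_minus_sinhc_sq: "(cosh (of_real t * s))\<^sup>2 - s\<^sup>2 * (sinhc t s)\<^sup>2 = 1"
  using hyperbolic_pythagoras[of "of_real t * s"]
  by (auto simp: sinhc_def power_divide)

lemma sing_max_scale: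
  assumes "c > 0"
  shows "sing_max (c\<^sup>2 * T) (c\<^sup>2 * d) = c * sing_max T d"
proof -
  have eq: "c\<^sup>2 * T + 2 * (c\<^sup>2 * d) = c\<^sup>2 * (T + 2 * d)" "c\<^sup>2 * T - 2 * (c\<^sup>2 * d) = c\<^sup>2 * (T - 2 * d)"
    by (simp_all add: algebra_simps)
  show ?thesis unfolding sing_max_def eq real_sqrt_mult using assms by (simp add: distrib_left)
qed

text \<open>The squared Frobenius norm of \<open>exp (-t m)\<close>, multiplied by \<open>exp t\<close>. It depends on \<open>s\<close> only through
  \<open>s\<^sup>2\<close>, so the choice of the root is immaterial.\<close>

definition gram_trace :: "real \<Rightarrow> real \<Rightarrow> real \<Rightarrow> real" where
  "gram_trace a b t =
    (let s = csqrt ((Complex 1 b)\<^sup>2 / 4 - of_real a)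
     in 2 * (cmod (cosh (of_real t * s)))\<^sup>2 + (1 + b\<^sup>2 + 4 * a) / 2 * (cmod (sinhc t s))\<^sup>2)"

lemma cmod_parallelogram: "(cmod (x - y))\<^sup>2 + (cmod (x + y))\<^sup>2 = 2 * (cmod x)\<^sup>2 + 2 * (cmod y)\<^sup>2"
  unfolding cmod_power2 by (simp add: algebra_simps power2_eq_square)

text \<open>The scalar \<open>exp (-t z/2)\<close> factors out of \<open>exp (-t m)\<close>. What remains has determinant \<open>1\<close>, by
  \<open>cosh\<^sup>2 - sinh\<^sup>2 = 1\<close>, and the parallelogram law combines the two diagonal entries.\<close>

lemma op_norm_exp_M_ab:
  assumes "a > 0"
  shows "op_norm (mat_exp ((- t) *\<^sub>R M_ab a b)) = exp (- t / 2) * sing_max (gram_trace a b t) 1"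
proof -
  define s where "s = csqrt ((Complex 1 b)\<^sup>2 / 4 - of_real a)"
  have s2: "s\<^sup>2 = (Complex 1 b)\<^sup>2 / 4 - of_real a" by (simp add: s_def)
  then have s: "(Complex 1 b)\<^sup>2 = 4 * (s\<^sup>2 + of_real a)" by simp
  define E where "E = exp (- (of_real t * Complex 1 b / 2))"
  define c where "c = cosh (of_real t * s)"
  define d where "d = sinhc t s"
  have trace: "gram_trace a b t = 2 * (cmod c)\<^sup>2 + (1 + b\<^sup>2 + 4 * a) / 2 * (cmod d)\<^sup>2"
    by (simp only: gram_trace_def Let_def s_def c_def d_def)
  have cd: "c\<^sup>2 - s\<^sup>2 * d\<^sup>2 = 1" unfolding c_def d_def by (rule cosh_sq_minus_sinhc_sq)
  have E: "cmod E = exp (- t / 2)" by (simp add: E_def)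
  have sa: "complex_of_real (sqrt a) * of_real (sqrt a) = of_real a"
    using assms by (simp flip: of_real_mult)
  have "E * (c - Complex 1 b / 2 * d) * (E * (c + Complex 1 b / 2 * d))
        - (- of_real (sqrt a) * E * d) * (of_real (sqrt a) * E * d) =
      E\<^sup>2 * (c\<^sup>2 - (Complex 1 b)\<^sup>2 / 4 * d\<^sup>2 + (of_real (sqrt a) * of_real (sqrt a)) * d\<^sup>2)"
    by (simp add: algebra_simps power2_eq_square)
  also have "\<dots> = E\<^sup>2 * (c\<^sup>2 - s\<^sup>2 * d\<^sup>2)" unfolding sa s2 by (simp add: algebra_simps)
  finally have det: "cmod (E * (c - Complex 1 b / 2 * d) * (E * (c + Complex 1 b / 2 * d))
        - (- of_real (sqrt a) * E * d) * (of_real (sqrt a) * E * d)) = (exp (- t / 2))\<^sup>2 * 1"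
    by (simp add: cd norm_power E)
  have z: "(cmod (Complex 1 b / 2))\<^sup>2 = (1 + b\<^sup>2) / 4"
    by (simp add: norm_divide power_divide cmod_power2)
  have "(cmod (E * (c - Complex 1 b / 2 * d)))\<^sup>2 + (cmod (- of_real (sqrt a) * E * d))\<^sup>2 +
      (cmod (of_real (sqrt a) * E * d))\<^sup>2 + (cmod (E * (c + Complex 1 b / 2 * d)))\<^sup>2 =
      (cmod E)\<^sup>2 * (((cmod (c - Complex 1 b / 2 * d))\<^sup>2 + (cmod (c + Complex 1 b / 2 * d))\<^sup>2)
         + 2 * (a * (cmod d)\<^sup>2))"
    unfolding norm_mult power_mult_distrib using assms by (simp add: algebra_simps)
  also have "\<dots> = (exp (- t / 2))\<^sup>2 * gram_trace a b t"
    unfolding cmod_parallelogram norm_mult[of _ d] power_mult_distrib z E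
    by (simp add: trace field_simps)
  finally show ?thesis
    unfolding mat_exp_M_ab[OF assms s] op_norm_realify E_def[symmetric] c_def[symmetric] d_def[symmetric] det
    using sing_max_scale[of "exp (- t / 2)" "gram_trace a b t" 1] by simp
qed

text \<open>The numbers \<open>e\<^sub>k\<close> with \<open>F(t) = \<Sum>\<^sub>k e\<^sub>k t^(2k) / (2k)!\<close>. The recursion exhibits them as
  polynomials in \<open>a\<close> and \<open>b\<^sup>2\<close>, which covers the degenerate case \<open>A = 0\<close> as well.\<close>

fun gram_coeff :: "real \<Rightarrow> real \<Rightarrow> nat \<Rightarrow> real" where
  "gram_coeff a b 0 = 2"
| "gram_coeff a b (Suc 0) = 2"
| "gram_coeff a b (Suc (Suc k)) = (1 - b\<^sup>2 - 4 * a) * gram_coeff a b (Suc k) + b\<^sup>2 * gram_coeff a b k"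

text \<open>The factor \<open>1 + b\<^sup>2 + 4 a\<close> enters through the norm of \<open>m - z/2\<close>; it makes the value at
  \<open>k = 1\<close> equal to \<open>2\<close>.\<close>

lemma gram_coeff_closed:
  fixes p q :: complex and a b :: real
  assumes "p + q = of_real (1 - b\<^sup>2 - 4 * a)" "p * q = - of_real (b\<^sup>2)" "p \<noteq> q"
  shows "of_real (gram_coeff a b k) = p ^ k + q ^ k + of_real (1 + b\<^sup>2 + 4 * a) / (p - q) * (p ^ k - q ^ k)"
proof (induction k rule: induct_nat_012)
  case 1
  have "p + q + of_real (1 + b\<^sup>2 + 4 * a) = (2 :: complex)" unfolding assms(1) by simp
  then show ?case using assms(3) by simp
next
  case (ge2 n)
  define K where "K = complex_of_real (1 + b\<^sup>2 + 4 * a) / (p - q)"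
  have "complex_of_real (gram_coeff a b (Suc (Suc n))) =
     of_real (1 - b\<^sup>2 - 4 * a) * of_real (gram_coeff a b (Suc n)) - (- of_real (b\<^sup>2)) * of_real (gram_coeff a b n)"
    by simp
  also have "\<dots> = (p + q) * (p ^ Suc n + q ^ Suc n + K * (p ^ Suc n - q ^ Suc n)) -
     p * q * (p ^ n + q ^ n + K * (p ^ n - q ^ n))"
    unfolding ge2 assms(1,2) K_def by simp
  also have "\<dots> = p ^ Suc (Suc n) + q ^ Suc (Suc n) + K * (p ^ Suc (Suc n) - q ^ Suc (Suc n))"
    by (simp add: algebra_simps)
  finally show ?case by (simp add: K_def)
qed auto

lemma cosh_cnj: "cosh (cnj x) = cnj (cosh x)" and sinh_cnj: "sinh (cnj x) = cnj (sinh x)"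
  by (simp_all add: cosh_def sinh_def exp_cnj scaleR_conv_of_real flip: complex_cnj_minus)

text \<open>With \<open>P = s + cnj s\<close> and \<open>Q = s - cnj s\<close> the addition theorems turn \<open>\<bar>cosh (t s)\<bar>\<^sup>2\<close> and
  \<open>\<bar>sinh (t s)\<bar>\<^sup>2\<close> into half the sum and half the difference of \<open>cosh (t P)\<close> and \<open>cosh (t Q)\<close>.
  Moreover \<open>P\<^sup>2 - Q\<^sup>2 = 4 \<bar>s\<bar>\<^sup>2\<close>, and the sum and product of \<open>P\<^sup>2\<close> and \<open>Q\<^sup>2\<close> are,
  up to the sign of the product, the coefficients in the recursion for \<open>e\<^sub>k\<close>.\<close>

lemma gram_trace_series:
  "(\<lambda>n. if even n then gram_coeff a b (n div 2) * t ^ n / fact n else 0) sums gram_trace a b t"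
proof -
  define s where "s = csqrt ((Complex 1 b)\<^sup>2 / 4 - of_real a)"
  have s2: "s\<^sup>2 = (Complex 1 b)\<^sup>2 / 4 - of_real a" by (simp add: s_def)
  have re: "Re (s\<^sup>2) = (1 - b\<^sup>2) / 4 - a" and im: "Im (s\<^sup>2) = b / 2"
    unfolding s2 by (simp_all add: power2_eq_square)
  show ?thesis
  proof (cases "s = 0")
    case True
    \<comment> \<open>the double eigenvalue: \<open>F\<close> is the polynomial \<open>2 + t\<^sup>2\<close>\<close>
    then have "b = 0" "a = 1 / 4" using re im by auto
    have "(\<lambda>n. if even n then gram_coeff a b (n div 2) * t ^ n / fact n else 0) sums
       (\<Sum>n\<in>{0,2}. if even n then gram_coeff a b (n div 2) * t ^ n / fact n else 0)"
    proof (intro sums_finite)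
      fix n :: nat assume n: "n \<notin> {0, 2}"
      show "(if even n then gram_coeff a b (n div 2) * t ^ n / fact n else 0) = 0"
      proof (cases "even n")
        case True
        then obtain m where "n = 2 * m" by blast
        moreover from this n have "m \<noteq> 0" "m \<noteq> 1" by auto
        then obtain k where "m = Suc (Suc k)" by (metis One_nat_def not0_implies_Suc)
        ultimately show ?thesis by (simp add: \<open>a = 1/4\<close> \<open>b = 0\<close>)
      qed simp
    qed simp
    then show ?thesis
      using True by (simp add: gram_trace_def sinhc_def \<open>b = 0\<close> \<open>a = 1/4\<close> flip: s_def)
  next
    case False
    define P Q where "P = s + cnj s" and "Q = s - cnj s"
    have pq: "P\<^sup>2 + Q\<^sup>2 = 2 * (s\<^sup>2 + cnj (s\<^sup>2))" "P\<^sup>2 * Q\<^sup>2 = (s\<^sup>2 - cnj (s\<^sup>2))\<^sup>2"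
      by (simp_all add: P_def Q_def power2_eq_square algebra_simps)
    have sum: "P\<^sup>2 + Q\<^sup>2 = of_real (1 - b\<^sup>2 - 4 * a)"
      unfolding pq complex_add_cnj re by simp
    have prod: "P\<^sup>2 * Q\<^sup>2 = - of_real (b\<^sup>2)"
      unfolding pq complex_diff_cnj im by (simp add: power_mult_distrib)
    have diff: "P\<^sup>2 - Q\<^sup>2 = 4 * of_real ((cmod s)\<^sup>2)"
      unfolding complex_norm_square P_def Q_def by (simp add: power2_eq_square algebra_simps)
    define K where "K = complex_of_real (1 + b\<^sup>2 + 4 * a) / (P\<^sup>2 - Q\<^sup>2)"
    have "P\<^sup>2 \<noteq> Q\<^sup>2" using diff False by auto
    note coeff = gram_coeff_closed[OF sum prod this, folded K_def]
    define T where "T = of_real t * s"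
    have TP: "of_real t * P = T + cnj T" and TQ: "of_real t * Q = T - cnj T"
      by (simp_all add: T_def P_def Q_def algebra_simps)
    let ?c = "\<lambda>x n. if even n then (of_real t * x) ^ n /\<^sub>R fact n else (0::complex)"
    have "(\<lambda>n. ?c P n + ?c Q n + K * (?c P n - ?c Q n)) sums
       (cosh (of_real t * P) + cosh (of_real t * Q) + K * (cosh (of_real t * P) - cosh (of_real t * Q)))"
      by (intro sums_add sums_mult sums_diff cosh_converges)
    also have "(\<lambda>n. ?c P n + ?c Q n + K * (?c P n - ?c Q n)) =
      (\<lambda>n. of_real (if even n then gram_coeff a b (n div 2) * t ^ n / fact n else 0))"
    proof
      fix n
      show "?c P n + ?c Q n + K * (?c P n - ?c Q n) =
         of_real (if even n then gram_coeff a b (n div 2) * t ^ n / fact n else 0)"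
      proof (cases "even n")
        case True
        then obtain m where m: "n = 2 * m" by blast
        have "?c x n = of_real (t ^ n / fact n) * (x\<^sup>2) ^ m" for x
          unfolding m power_mult[symmetric] by (simp add: scaleR_conv_of_real power_mult_distrib field_simps)
        then have "?c P n + ?c Q n + K * (?c P n - ?c Q n) =
            of_real (t ^ n / fact n) * of_real (gram_coeff a b m)"
          unfolding coeff by (simp only: ring_distribs mult_ac)
        then show ?thesis by (simp add: m mult_ac)
      qed simp
    qed
    also have "cosh (of_real t * P) + cosh (of_real t * Q) = 2 * (cosh T * cnj (cosh T))"
      unfolding TP TQ cosh_add cosh_diff cosh_cnj sinh_cnj by simp
    also have "cosh (of_real t * P) - cosh (of_real t * Q) = 2 * (sinh T * cnj (sinh T))"
      unfolding TP TQ cosh_add cosh_diff cosh_cnj sinh_cnj by simp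
    also have "2 * (cosh T * cnj (cosh T)) + K * (2 * (sinh T * cnj (sinh T))) =
      of_real (2 * (cmod (cosh T))\<^sup>2 + (1 + b\<^sup>2 + 4 * a) / 2 * ((cmod (sinh T))\<^sup>2 / (cmod s)\<^sup>2))"
      unfolding K_def diff complex_norm_square[symmetric] by simp
    also have "2 * (cmod (cosh T))\<^sup>2 + (1 + b\<^sup>2 + 4 * a) / 2 * ((cmod (sinh T))\<^sup>2 / (cmod s)\<^sup>2) = gram_trace a b t"
      using False
      by (simp add: gram_trace_def sinhc_def norm_divide power_divide flip: s_def T_def)
    finally show ?thesis by (rule sums_of_real_iff[THEN iffD1])
  qed
qed

section \<open>Power series estimates\<close>

text \<open>Cauchy's estimate for \<open>f - f 0\<close> on the circle of radius \<open>R\<close> gives coefficients of size at most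
  \<open>C R / R\<^sup>n\<close> for \<open>n \<ge> 1\<close>, and the tail is dominated by a geometric series of ratio at most \<open>1/2\<close>.
  The linear bound on \<open>f - f 0\<close> gains the factor \<open>\<bar>t\<bar>\<close> in place of \<open>R\<close>.\<close>

lemma taylor_remainder_le:
  fixes f :: "complex \<Rightarrow> complex" and R C :: real
  assumes hol: "f holomorphic_on cball 0 R" and R: "0 < R" and C: "0 < C"
    and bound: "\<And>z. cmod z \<le> R \<Longrightarrow> cmod (f z - f 0) \<le> C * cmod z"
    and t: "cmod t \<le> R / 2"
  shows "cmod (f t - (\<Sum>n\<le>N. (deriv ^^ n) f 0 / fact n * t ^ n)) \<le> 2 * C * cmod t * (cmod t / R) ^ N"
proof -
  define g where "g n = (deriv ^^ n) f 0 / fact n * t ^ n" for n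
  define x where "x = cmod t / R"
  have x: "0 \<le> x" "x \<le> 1 / 2" using t R by (simp_all add: x_def field_simps)
  have hol': "f holomorphic_on ball 0 R" by (rule holomorphic_on_subset[OF hol]) auto
  have coeff: "cmod ((deriv ^^ n) f 0) \<le> fact n * (C * R) / R ^ n" if "0 < n" for n
  proof (rule Cauchy_higher_deriv_bound[where y = "f 0"])
    fix w :: complex assume w: "w \<in> ball 0 R"
    then have "cmod (f w - f 0) \<le> C * cmod w" by (intro bound) auto
    also have "\<dots> < C * R" using w C by simp
    finally show "f w \<in> ball (f 0) (C * R)" by (simp add: dist_norm norm_minus_commute)
  qed (use hol hol' R that in \<open>auto intro: holomorphic_on_imp_continuous_on\<close>)
  have g: "norm (g n) \<le> C * R * x ^ n" if "0 < n" for n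
  proof -
    have "cmod ((deriv ^^ n) f 0) / fact n * cmod t ^ n \<le> fact n * (C * R) / R ^ n / fact n * cmod t ^ n"
      by (intro mult_right_mono divide_right_mono coeff that) simp_all
    then show ?thesis by (simp add: g_def norm_mult norm_divide norm_power x_def power_divide)
  qed
  have "g sums f t"
    using holomorphic_power_series[OF hol', of t] t R by (simp add: g_def[abs_def])
  then have tail: "(\<lambda>n. g (n + Suc N)) sums (f t - (\<Sum>n<Suc N. g n))"
    by (rule sums_split_initial_segment)
  have geom: "(\<lambda>n. C * R * x ^ Suc N * x ^ n) sums (C * R * x ^ Suc N * (1 / (1 - x)))"
    using x by (intro sums_mult geometric_sums) auto
  have "cmod (\<Sum>n. g (n + Suc N)) \<le> (\<Sum>n. C * R * x ^ Suc N * x ^ n)"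
    using g[of "_ + Suc N"] by (intro norm_suminf_le sums_summable[OF geom]) (simp add: power_add mult_ac)
  also have "\<dots> = C * R * x ^ Suc N * (1 / (1 - x))" using geom by (simp add: sums_iff)
  also have "\<dots> \<le> C * R * x ^ Suc N * 2"
    using x C R by (intro mult_left_mono) (auto simp: field_simps)
  also have "\<dots> = 2 * C * cmod t * x ^ N" using R by (simp add: x_def)
  finally show ?thesis using tail by (simp add: sums_iff lessThan_Suc_atMost g_def x_def)
qed

lemma fps_geometric_bound:
  fixes F :: "complex fps" and K :: real
  assumes K: "0 < K" and coeff: "\<And>n. cmod (fps_nth F n) \<le> K ^ n"
  shows "ereal (1 / (2 * K)) \<le> fps_conv_radius F"
    and "cmod z \<le> 1 / (3 * K) \<Longrightarrow> cmod (eval_fps F z - fps_nth F 0) \<le> 1 / 2"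
proof -
  have term_le: "norm (fps_nth F n * z ^ n) \<le> (K * cmod z) ^ n" for n z
    using coeff[of n] by (simp add: norm_mult norm_power power_mult_distrib mult_right_mono)
  \<comment> \<open>a test point at which the series is dominated by a geometric series of ratio \<open>1/2\<close>\<close>
  define w where "w = complex_of_real (1 / (2 * K))"
  have w: "cmod w = 1 / (2 * K)" using K unfolding w_def norm_of_real by simp
  have "summable (\<lambda>n. fps_nth F n * w ^ n)"
  proof (rule summable_comparison_test')
    show "summable (\<lambda>n. (1 / 2 :: real) ^ n)" by simp
    show "norm (fps_nth F n * w ^ n) \<le> (1 / 2) ^ n" for n
      using term_le[of n w] K by (simp add: w)
  qed
  from conv_radius_geI[OF this] show radius: "ereal (1 / (2 * K)) \<le> fps_conv_radius F"
    by (simp add: fps_conv_radius_def w)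
  assume z: "cmod z \<le> 1 / (3 * K)"
  define x where "x = K * cmod z"
  have x: "0 \<le> x" "x \<le> 1 / 3" using z K by (simp_all add: x_def field_simps)
  have "ereal (cmod z) < ereal (1 / (2 * K))" using z K by (simp add: field_simps)
  then have "cmod z < fps_conv_radius F" using radius by (rule less_le_trans)
  then have "(\<lambda>n. fps_nth F n * z ^ n) sums eval_fps F z" by (rule sums_eval_fps)
  then have tail: "(\<lambda>n. fps_nth F (n + 1) * z ^ (n + 1)) sums (eval_fps F z - (\<Sum>n<1. fps_nth F n * z ^ n))"
    by (rule sums_split_initial_segment)
  have geom: "(\<lambda>n. x * x ^ n) sums (x * (1 / (1 - x)))"
    using x by (intro sums_mult geometric_sums) auto
  have "cmod (\<Sum>n. fps_nth F (n + 1) * z ^ (n + 1)) \<le> (\<Sum>n. x * x ^ n)"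
    using term_le[of "_ + 1" z] by (intro norm_suminf_le sums_summable[OF geom]) (simp add: x_def)
  also have "\<dots> = x * (1 / (1 - x))" using geom by (simp add: sums_iff)
  also have "\<dots> \<le> 1 / 2" using x by (simp add: field_simps)
  finally show "cmod (eval_fps F z - fps_nth F 0) \<le> 1 / 2" using tail by (simp add: sums_iff)
qed

text \<open>Comparing coefficients in \<open>P\<^sup>2 = H\<close> determines \<open>P\<close> recursively from its constant term.\<close>

lemma fps_sqrt_coeffs:
  fixes P H :: "'a::field_char_0 fps"
  assumes H: "P * P = H" and P0: "fps_nth P 0 = 1"
    and odd: "fps_nth H 1 = 0" "fps_nth H 3 = 0" "fps_nth H 5 = 0"
  shows "fps_nth P 1 = 0" "fps_nth P 3 = 0" "fps_nth P 5 = 0"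
    "fps_nth P 2 = fps_nth H 2 / 2"
    "fps_nth P 4 = fps_nth H 4 / 2 - (fps_nth H 2)\<^sup>2 / 8"
    "fps_nth P 6 = fps_nth H 6 / 2 - fps_nth H 2 * fps_nth H 4 / 4 + (fps_nth H 2) ^ 3 / 16"
proof -
  note nth = H[symmetric] fps_mult_nth atLeast0AtMost numeral_eq_Suc
  have H1: "fps_nth H 1 = 2 * fps_nth P 1" by (simp add: nth P0)
  then show P1: "fps_nth P 1 = 0" using odd by simp
  have H2: "fps_nth H 2 = 2 * fps_nth P 2" using P1 by (simp add: nth P0)
  then show P2: "fps_nth P 2 = fps_nth H 2 / 2" by simp
  have H3: "fps_nth H 3 = 2 * fps_nth P 3" using P1 by (simp add: nth P0)
  then show P3: "fps_nth P 3 = 0" using odd by simp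
  have H4: "fps_nth H 4 = 2 * fps_nth P 4 + (fps_nth P 2)\<^sup>2" using P1 by (simp add: nth P0 power2_eq_square)
  then show P4: "fps_nth P 4 = fps_nth H 4 / 2 - (fps_nth H 2)\<^sup>2 / 8" using P2 by (simp add: power2_eq_square field_simps)
  have H5: "fps_nth H 5 = 2 * fps_nth P 5" using P1 P3 by (simp add: nth P0)
  then show P5: "fps_nth P 5 = 0" using odd by simp
  have H6: "fps_nth H 6 = 2 * fps_nth P 6 + 2 * fps_nth P 2 * fps_nth P 4"
    using P1 P3 P5 by (simp add: nth P0 algebra_simps)
  then have "fps_nth P 6 = fps_nth H 6 / 2 - fps_nth P 2 * fps_nth P 4" by (simp add: field_simps)
  then show "fps_nth P 6 = fps_nth H 6 / 2 - fps_nth H 2 * fps_nth H 4 / 4 + (fps_nth H 2) ^ 3 / 16"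
    unfolding P2 P4 by (simp add: power2_eq_square power3_eq_cube field_simps)
qed

text \<open>The quotient of \<open>w\<close> by \<open>\<surd>(1 + w) - 1\<close> is \<open>\<surd>(1 + w) + 1\<close>, whose real part is at least
  \<open>1\<close> for the principal root.\<close>

lemma cmod_csqrt_minus_1_le:
  "cmod (csqrt (1 + w) - 1) \<le> cmod w"
proof -
  have "(csqrt (1 + w) - 1) * (csqrt (1 + w) + 1) = (csqrt (1 + w))\<^sup>2 - 1"
    by (simp add: power2_eq_square algebra_simps)
  then have "cmod (csqrt (1 + w) - 1) * cmod (csqrt (1 + w) + 1) = cmod w"
    by (simp flip: norm_mult)
  moreover have "1 \<le> cmod (csqrt (1 + w) + 1)"
    using complex_Re_le_cmod[of "csqrt (1 + w) + 1"] csqrt_principal[of "1 + w"]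
    by (auto simp del: csqrt.simps)
  ultimately show ?thesis
    by (metis mult.right_neutral mult_left_mono norm_ge_zero)
qed

section \<open>Uniform expansion of the norm\<close>

text \<open>The series \<open>G\<close> with \<open>F(t) = 2 + t\<^sup>2 G(t)\<close>.\<close>

definition quot_fps :: "real \<Rightarrow> real \<Rightarrow> complex fps" where
  "quot_fps a b = Abs_fps (\<lambda>n. if even n then of_real (gram_coeff a b (Suc (n div 2)) / fact (n + 2)) else 0)"

text \<open>The holomorphic extension of the norm from small positive \<open>t\<close> to a complex disc about \<open>0\<close>.\<close>

definition norm_ext :: "real \<Rightarrow> real \<Rightarrow> complex \<Rightarrow> complex" where
  "norm_ext a b z = exp (- z / 2) *
     (csqrt (1 + z\<^sup>2 / 4 * eval_fps (quot_fps a b) z) + z / 2 * csqrt (eval_fps (quot_fps a b) z))"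

definition norm_coeff :: "nat \<Rightarrow> real \<Rightarrow> real \<Rightarrow> real" where
  "norm_coeff n a b = Re (fps_nth (fps_expansion (norm_ext a b) 0) n)"

text \<open>From \<open>b\<^sup>2 + 4 a = 1 - Re A\<close> and \<open>a > 0\<close>, the real part of \<open>A\<close> alone controls \<open>b\<^sup>2\<close>.\<close>

lemma bracket_A_ab_bounds:
  fixes a b :: real
  assumes "a > 0"
  defines "L \<equiv> bracket (A_ab a b)"
  shows "1 \<le> L" "\<bar>1 - b\<^sup>2 - 4 * a\<bar> \<le> L" "b\<^sup>2 \<le> 2 * L"
proof -
  show L: "1 \<le> L" by (simp add: L_def bracket_def)
  have "\<bar>1 - b\<^sup>2 - 4 * a\<bar> \<le> cmod (A_ab a b)"
    using abs_Re_le_cmod[of "A_ab a b"] by (simp add: A_ab_def)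
  also have "\<dots> \<le> L" unfolding L_def bracket_def by (rule real_le_rsqrt) simp
  finally show A: "\<bar>1 - b\<^sup>2 - 4 * a\<bar> \<le> L" .
  show "b\<^sup>2 \<le> 2 * L" using A L assms by linarith
qed

text \<open>The value \<open>e\<^sub>1 = 2\<close> carries no power of \<open>L\<close>, and since the coefficients of the recursion are at
  most \<open>L\<close> and \<open>2 L\<close>, each further index costs only one factor \<open>3 L\<close>.\<close>

lemma gram_coeff_bound:
  assumes "a > 0"
  shows "\<bar>gram_coeff a b (Suc k)\<bar> \<le> 2 * (3 * bracket (A_ab a b)) ^ k"
proof -
  define L where "L = bracket (A_ab a b)"
  note L = bracket_A_ab_bounds[OF assms, of b, folded L_def]
  have "\<bar>gram_coeff a b (Suc k)\<bar> \<le> 2 * (3 * L) ^ k"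
  proof (induction k rule: induct_nat_012)
    case 1
    have "gram_coeff a b (Suc 1) = 2 * (1 - 4 * a)" by (simp add: algebra_simps)
    moreover have "\<bar>1 - 4 * a\<bar> \<le> 3 * L" using L assms zero_le_power2[of b] by linarith
    ultimately show ?case by (simp add: abs_mult)
  next
    case (ge2 n)
    have "\<bar>gram_coeff a b (Suc (Suc (Suc n)))\<bar> \<le>
        \<bar>1 - b\<^sup>2 - 4 * a\<bar> * \<bar>gram_coeff a b (Suc (Suc n))\<bar> + b\<^sup>2 * \<bar>gram_coeff a b (Suc n)\<bar>"
      unfolding gram_coeff.simps(3)[of a b "Suc n"]
      by (rule order_trans[OF abs_triangle_ineq]) (simp add: abs_mult)
    also have "\<dots> \<le> L * (2 * (3 * L) ^ Suc n) + 2 * L * (2 * (3 * L) ^ n)"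
      using L by (intro add_mono mult_mono ge2) auto
    also have "\<dots> \<le> 3 * L * (2 * (3 * L) ^ Suc n)"
    proof -
      have "2 * L * (2 * (3 * L) ^ n) * 1 \<le> 2 * L * (2 * (3 * L) ^ n) * (3 * L)"
        using L by (intro mult_left_mono) auto
      then show ?thesis by (simp add: algebra_simps)
    qed
    finally show ?case by simp
  qed simp
  then show ?thesis by (simp add: L_def)
qed

lemma quot_fps_bound:
  assumes "a > 0"
  shows "cmod (fps_nth (quot_fps a b) n) \<le> (2 * sqrt (bracket (A_ab a b))) ^ n"
proof (cases "even n")
  case True
  define L where "L = bracket (A_ab a b)"
  have L: "1 \<le> L" unfolding L_def using assms by (rule bracket_A_ab_bounds)
  from True obtain k where k: "n = 2 * k" by blast
  have "cmod (fps_nth (quot_fps a b) n) = \<bar>gram_coeff a b (Suc k)\<bar> / fact (n + 2)"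
    using True unfolding quot_fps_def fps_nth_Abs_fps by (simp only: if_True norm_of_real) (simp add: k)
  also have "\<dots> \<le> 2 * (3 * L) ^ k / 2"
  proof (intro frac_le)
    have "fact 2 \<le> (fact (n + 2) :: real)" by (rule fact_mono) simp
    then show "2 \<le> (fact (n + 2) :: real)" by simp
  qed (use L gram_coeff_bound[OF assms, of b k] in \<open>auto simp: L_def\<close>)
  also have "\<dots> \<le> (4 * L) ^ k" using L by (simp add: power_mono)
  also have "4 * L = (2 * sqrt L)\<^sup>2" using L by (simp add: power_mult_distrib)
  finally show ?thesis by (simp add: k L_def power_mult)
qed (use bracket_A_ab_bounds(1)[OF assms, of b] in \<open>simp add: quot_fps_def\<close>)

text \<open>On the disc of radius \<open>R\<close>, proportional to \<open>L\<^bsup>-1/2\<^esup>\<close>, all estimates hold with constants that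
  do not depend on \<open>a\<close> and \<open>b\<close>.\<close>

context
  fixes a b R :: real
  assumes a: "a > 0"
  defines "R \<equiv> 1 / (6 * sqrt (bracket (A_ab a b)))"
begin

lemma radius: "0 < R" "R \<le> 1 / 6"
  using bracket_A_ab_bounds(1)[OF a, of b] by (auto simp: R_def field_simps)

lemma quot_near_1:
  assumes "cmod z \<le> R"
  shows "cmod (eval_fps (quot_fps a b) z - 1) \<le> 1 / 2"
proof -
  have "0 < 2 * sqrt (bracket (A_ab a b))" using bracket_A_ab_bounds(1)[OF a, of b] by simp
  from fps_geometric_bound(2)[OF this quot_fps_bound[OF a], of z] assms show ?thesis
    by (simp add: R_def quot_fps_def)
qed

lemma conv_radius_quot: "R < fps_conv_radius (quot_fps a b)"
proof -
  have L: "0 < 2 * sqrt (bracket (A_ab a b))" using bracket_A_ab_bounds(1)[OF a, of b] by simp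
  have "ereal R < ereal (1 / (2 * (2 * sqrt (bracket (A_ab a b)))))"
    using L by (simp add: R_def field_simps)
  also have "\<dots> \<le> fps_conv_radius (quot_fps a b)"
    by (rule fps_geometric_bound(1)[OF L quot_fps_bound[OF a]])
  finally show ?thesis .
qed

lemma inside_conv_radius:
  assumes "cmod z \<le> R"
  shows "cmod z < fps_conv_radius (quot_fps a b)"
  using assms conv_radius_quot by (meson ereal_less_eq(3) le_less_trans)

lemma quot_holomorphic: "eval_fps (quot_fps a b) holomorphic_on cball 0 R"
  by (rule holomorphic_on_eval_fps) (use inside_conv_radius in \<open>auto simp: in_eball_iff\<close>)

text \<open>Both radicands lie in the right half plane, where the principal root is holomorphic. The bound
  \<open>R \<le> 1/6\<close> turns the quadratic smallness of \<open>z\<^sup>2 G / 4\<close> into a linear one.\<close>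

lemma sqrt_args:
  assumes "cmod z \<le> R"
  defines "g \<equiv> eval_fps (quot_fps a b) z"
  shows "Re g > 0" "cmod g \<le> 3 / 2" "cmod (z\<^sup>2 / 4 * g) \<le> cmod z / 8" "Re (1 + z\<^sup>2 / 4 * g) > 0"
proof -
  have g: "cmod (g - 1) \<le> 1 / 2" unfolding g_def using assms(1) by (rule quot_near_1)
  show "Re g > 0" using g abs_Re_le_cmod[of "g - 1"] by simp
  show g': "cmod g \<le> 3 / 2" using g norm_triangle_ineq[of "g - 1" 1] by simp
  have "cmod (z\<^sup>2 / 4 * g) = cmod z * (cmod z * cmod g / 4)"
    by (simp add: norm_mult norm_divide norm_power power2_eq_square)
  also have "\<dots> \<le> cmod z * (1 / 6 * (3 / 2) / 4)"
    using assms(1) radius g' by (intro mult_left_mono divide_right_mono mult_mono) auto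
  also have "\<dots> \<le> cmod z / 8" by simp
  finally show w: "cmod (z\<^sup>2 / 4 * g) \<le> cmod z / 8" .
  have "\<bar>Re (z\<^sup>2 / 4 * g)\<bar> < 1"
    using abs_Re_le_cmod[of "z\<^sup>2 / 4 * g"] w assms(1) radius by linarith
  then show "Re (1 + z\<^sup>2 / 4 * g) > 0" unfolding plus_complex.sel one_complex.sel by linarith
qed

lemma norm_ext_holomorphic:
  "(\<lambda>z. csqrt (1 + z\<^sup>2 / 4 * eval_fps (quot_fps a b) z)) holomorphic_on cball 0 R"
  "(\<lambda>z. csqrt (eval_fps (quot_fps a b) z)) holomorphic_on cball 0 R"
  "norm_ext a b holomorphic_on cball 0 R"
proof -
  have root: "(\<lambda>z. csqrt (f z)) holomorphic_on cball 0 R"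
    if "f holomorphic_on cball 0 R" "\<And>z. cmod z \<le> R \<Longrightarrow> Re (f z) > 0" for f
    using that by (intro holomorphic_on_csqrt') (force simp: complex_nonpos_Reals_iff)+
  show P: "(\<lambda>z. csqrt (1 + z\<^sup>2 / 4 * eval_fps (quot_fps a b) z)) holomorphic_on cball 0 R"
    by (rule root[OF _ sqrt_args(4)])
      (auto intro!: holomorphic_on_add holomorphic_on_mult quot_holomorphic holomorphic_intros)
  show Q: "(\<lambda>z. csqrt (eval_fps (quot_fps a b) z)) holomorphic_on cball 0 R"
    by (rule root[OF quot_holomorphic sqrt_args(1)])
  show "norm_ext a b holomorphic_on cball 0 R"
    unfolding norm_ext_def[abs_def] by (intro holomorphic_intros P Q) auto
qed

lemma norm_ext_0: "norm_ext a b 0 = 1"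
  by (simp add: norm_ext_def)

text \<open>Each of the three parts \<open>exp (-z/2) - 1\<close>, \<open>\<surd>(1 + z\<^sup>2 G / 4) - 1\<close> and \<open>z/2 \<surd>G\<close> is
  \<open>O(z)\<close> uniformly in \<open>a\<close> and \<open>b\<close>.\<close>

lemma norm_ext_near_1:
  assumes z: "cmod z \<le> R"
  shows "cmod (norm_ext a b z - 1) \<le> 8 * cmod z"
proof -
  define g where "g = eval_fps (quot_fps a b) z"
  define E P Q where "E = exp (- z / 2)" and "P = csqrt (1 + z\<^sup>2 / 4 * g)" and "Q = csqrt g"
  note g = sqrt_args[OF z, folded g_def]
  have e: "exp x \<le> 3" if "x \<le> 1" for x :: real
    using that exp_le by (meson exp_le_cancel_iff order_trans)
  have half: "cmod (- z / 2) = cmod z / 2" by (simp add: norm_divide)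
  have "cmod (E - 1) \<le> exp \<bar>Re (- z / 2)\<bar> * cmod (- z / 2)"
    using Taylor_exp[of "- z / 2" 0] by (simp add: E_def)
  also have "\<dots> \<le> 3 * cmod (- z / 2)"
  proof (intro mult_right_mono e)
    show "\<bar>Re (- z / 2)\<bar> \<le> 1" using abs_Re_le_cmod[of "- z / 2"] z radius unfolding half by linarith
  qed simp
  finally have E1: "cmod (E - 1) \<le> 3 * (cmod z / 2)" unfolding half .
  have "cmod E \<le> exp (cmod (- z / 2))" unfolding E_def by (rule norm_exp)
  also have "\<dots> \<le> 3" using z radius unfolding half by (intro e) linarith
  finally have E: "cmod E \<le> 3" .
  have "cmod (P - 1) \<le> cmod (z\<^sup>2 / 4 * g)" unfolding P_def by (rule cmod_csqrt_minus_1_le)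
  then have P: "cmod (P - 1) \<le> cmod z / 8" using g(3) by linarith
  have Q: "cmod Q \<le> 2" unfolding Q_def norm_csqrt using g(2) by (intro real_le_lsqrt) auto
  have "norm_ext a b z - 1 = (E - 1) + E * (P - 1) + E * (z / 2 * Q)"
    by (simp add: norm_ext_def E_def P_def Q_def g_def algebra_simps)
  also have "cmod \<dots> \<le> cmod (E - 1) + cmod E * cmod (P - 1) + cmod E * (cmod z / 2 * cmod Q)"
    by (intro order_trans[OF norm_triangle_ineq] add_mono) (simp_all add: norm_mult norm_divide)
  also have "\<dots> \<le> 3 * (cmod z / 2) + 3 * (cmod z / 8) + 3 * (cmod z / 2 * 2)"
    using E1 E P Q by (intro add_mono mult_mono) auto
  also have "\<dots> \<le> 8 * cmod z" by simp
  finally show ?thesis .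
qed

lemma norm_ext_real:
  assumes t: "0 < t" "t \<le> R"
  shows "norm_ext a b (of_real t) = of_real (op_norm (mat_exp ((- t) *\<^sub>R M_ab a b)))"
proof -
  define z where "z = complex_of_real t"
  define g where "g = (gram_trace a b t - 2) / t\<^sup>2"
  have z: "cmod z \<le> R" using t by (simp add: z_def)
  define f where "f n = (if even n then gram_coeff a b (n div 2) * t ^ n / fact n else 0) / t\<^sup>2" for n
  have "f sums (gram_trace a b t / t\<^sup>2)"
    unfolding f_def by (intro sums_divide gram_trace_series)
  then have "(\<lambda>n. f (n + 2)) sums (gram_trace a b t / t\<^sup>2 - (\<Sum>n<2. f n))"
    by (rule sums_split_initial_segment)
  also have "gram_trace a b t / t\<^sup>2 - (\<Sum>n<2. f n) = g"
    by (simp add: g_def f_def numeral_2_eq_2 diff_divide_distrib)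
  finally have "(\<lambda>n. complex_of_real (f (n + 2))) sums of_real g"
    by (rule sums_of_real)
  also have "(\<lambda>n. complex_of_real (f (n + 2))) = (\<lambda>n. fps_nth (quot_fps a b) n * z ^ n)"
  proof
    fix n
    have "f (n + 2) = (if even n then gram_coeff a b (Suc (n div 2)) / fact (n + 2) else 0) * t ^ n"
      using t unfolding f_def power_add by auto
    then show "complex_of_real (f (n + 2)) = fps_nth (quot_fps a b) n * z ^ n"
      by (simp add: quot_fps_def z_def del: fact_Suc)
  qed
  finally have "(\<lambda>n. fps_nth (quot_fps a b) n * z ^ n) sums of_real g" .
  moreover have "cmod z < fps_conv_radius (quot_fps a b)"
    using z by (rule inside_conv_radius)
  ultimately have eval: "eval_fps (quot_fps a b) z = of_real g"
    using sums_eval_fps sums_unique2 by blast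
  have g: "g > 0" using sqrt_args(1)[OF z] eval by simp
  have trace: "gram_trace a b t = 2 + t\<^sup>2 * g" using t by (simp add: g_def)
  have "sqrt (2 + t\<^sup>2 * g + 2 * 1) = sqrt (4 * (1 + t\<^sup>2 / 4 * g))" by simp
  also have "\<dots> = 2 * sqrt (1 + t\<^sup>2 / 4 * g)" unfolding real_sqrt_mult by simp
  finally have s: "sing_max (gram_trace a b t) 1 = sqrt (1 + t\<^sup>2 / 4 * g) + t / 2 * sqrt g"
    using t by (simp add: trace sing_max_def real_sqrt_mult)
  have "1 + z\<^sup>2 / 4 * of_real g = of_real (1 + t\<^sup>2 / 4 * g)" by (simp add: z_def)
  moreover have "0 \<le> 1 + t\<^sup>2 / 4 * g" using g by simp
  ultimately have root: "csqrt (1 + z\<^sup>2 / 4 * of_real g) = of_real (sqrt (1 + t\<^sup>2 / 4 * g))"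
    by (simp only: csqrt_of_real)
  have root': "csqrt (of_real g) = of_real (sqrt g)" using g by (intro csqrt_of_real) simp
  have "- z / 2 = of_real (- t / 2)" by (simp add: z_def)
  then have exp: "exp (- z / 2) = of_real (exp (- t / 2))" by (simp only: exp_of_real)
  have "norm_ext a b z = of_real (exp (- t / 2) * (sqrt (1 + t\<^sup>2 / 4 * g) + t / 2 * sqrt g))"
    unfolding norm_ext_def eval root root' exp by (simp add: z_def)
  then show ?thesis unfolding op_norm_exp_M_ab[OF a] s by (simp only: z_def)
qed

lemma norm_remainder:
  assumes t: "0 < t" "t \<le> R / 2"
  shows "\<bar>op_norm (mat_exp ((- t) *\<^sub>R M_ab a b)) - (\<Sum>n\<le>N. norm_coeff n a b * t ^ n)\<bar> \<le> 16 * t * (t / R) ^ N"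
proof -
  let ?h = "norm_ext a b"
  have "cmod (?h (of_real t) - (\<Sum>n\<le>N. (deriv ^^ n) ?h 0 / fact n * of_real t ^ n))
      \<le> 2 * 8 * cmod (of_real t) * (cmod (of_real t) / R) ^ N"
    using t radius norm_ext_near_1
    by (intro taylor_remainder_le norm_ext_holomorphic) (auto simp: norm_ext_0)
  moreover have "Re (?h (of_real t) - (\<Sum>n\<le>N. (deriv ^^ n) ?h 0 / fact n * of_real t ^ n)) =
     op_norm (mat_exp ((- t) *\<^sub>R M_ab a b)) - (\<Sum>n\<le>N. norm_coeff n a b * t ^ n)"
  proof -
    have "Re (w * of_real t ^ n) = Re w * t ^ n" for w n by (simp flip: of_real_power)
    moreover have "t \<le> R" using t radius by simp
    ultimately show ?thesis
      by (simp only: minus_complex.sel Re_sum norm_coeff_def fps_expansion_def fps_nth_Abs_fps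
          norm_ext_real[OF t(1)] Re_complex_of_real)
  qed
  ultimately show ?thesis
    using abs_Re_le_cmod[of "?h (of_real t) - (\<Sum>n\<le>N. (deriv ^^ n) ?h 0 / fact n * of_real t ^ n)"] t by simp
qed

text \<open>The coefficients of \<open>G\<close> up to degree five determine those of the two square roots up to degrees six and
  five, and the product with the exponential series gives the result.\<close>

lemma norm_coeff_values:
  "norm_coeff 0 a b = 1" "norm_coeff 1 a b = 0" "norm_coeff 2 a b = 0"
  "norm_coeff 3 a b = - (a / 12)" "norm_coeff 4 a b = 0"
  "norm_coeff 5 a b = 1 / 360 * a * b\<^sup>2 + 1 / 240 * a\<^sup>2 + 1 / 120 * a"
  "norm_coeff 6 a b = 1 / 288 * a\<^sup>2"
proof -
  define G where "G = quot_fps a b"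
  define p q where "p z = csqrt (1 + z\<^sup>2 / 4 * eval_fps G z)" and "q z = csqrt (eval_fps G z)" for z
  define P Q where "P = fps_expansion p 0" and "Q = fps_expansion q 0"
  have hol: "f holomorphic_on ball 0 R" if "f holomorphic_on cball 0 R" for f
    by (rule holomorphic_on_subset[OF that]) auto
  have p: "p has_fps_expansion P"
    unfolding P_def p_def[abs_def] G_def
    by (intro has_fps_expansion_fps_expansion[of "ball 0 R"] hol norm_ext_holomorphic) (use radius in auto)
  have q: "q has_fps_expansion Q"
    unfolding Q_def q_def[abs_def] G_def
    by (intro has_fps_expansion_fps_expansion[of "ball 0 R"] hol norm_ext_holomorphic) (use radius in auto)
  have "0 < fps_conv_radius G"
    using less_trans[OF _ conv_radius_quot, of 0] radius by (simp add: G_def zero_ereal_def)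
  then have g: "eval_fps G has_fps_expansion G" by (rule eval_fps_has_fps_expansion)
  have "(\<lambda>z. p z * p z) has_fps_expansion P * P" by (intro fps_expansion_intros p)
  moreover have "(\<lambda>z. 1 + 1 / 4 * (z ^ 2 * eval_fps G z)) has_fps_expansion 1 + fps_const (1 / 4) * (fps_X ^ 2 * G)"
    by (intro fps_expansion_intros g)
  moreover have "p z * p z = 1 + 1 / 4 * (z ^ 2 * eval_fps G z)" for z
    unfolding p_def power2_eq_square[symmetric] power2_csqrt by simp
  ultimately have PP: "P * P = 1 + fps_const (1 / 4) * (fps_X ^ 2 * G)"
    using fps_expansion_unique_complex by simp
  have "(\<lambda>z. q z * q z) has_fps_expansion Q * Q" by (intro fps_expansion_intros q)
  moreover have "q z * q z = eval_fps G z" for z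
    unfolding q_def power2_eq_square[symmetric] power2_csqrt by simp
  ultimately have QQ: "Q * Q = G" using g fps_expansion_unique_complex by simp
  have gc: "gram_coeff a b 2 = 2 - 8 * a"
    "gram_coeff a b 3 = (1 - b\<^sup>2 - 4 * a) * (2 - 8 * a) + 2 * b\<^sup>2"
    by (simp_all add: numeral_eq_Suc algebra_simps)
  have G: "fps_nth G 0 = 1" "fps_nth G 1 = 0" "fps_nth G 2 = of_real ((1 - 4 * a) / 12)" "fps_nth G 3 = 0"
    "fps_nth G 4 = of_real (((1 - b\<^sup>2 - 4 * a) * (1 - 4 * a) + b\<^sup>2) / 360)" "fps_nth G 5 = 0"
    by (simp_all add: G_def quot_fps_def fact_numeral gc field_simps)
  have P0: "fps_nth P 0 = 1" and Q0: "fps_nth Q 0 = 1"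
    using G(1) by (simp_all add: P_def Q_def fps_expansion_def p_def q_def eval_fps_at_0)
  \<comment> \<open>\<open>P\<close> and \<open>Q\<close> are square roots of power series without terms of degree one, three and five\<close>
  define S where "S = 1 + fps_const (1 / 4) * (fps_X ^ 2 * G)"
  have "fps_nth S n = (if n = 0 then 1 else if n = 1 then 0 else fps_nth G (n - 2) / 4)" for n
    by (simp add: S_def fps_X_power_mult_nth)
  then have S: "fps_nth S 1 = 0" "fps_nth S 3 = 0" "fps_nth S 5 = 0"
    "fps_nth S 2 = fps_nth G 0 / 4" "fps_nth S 4 = fps_nth G 2 / 4" "fps_nth S 6 = fps_nth G 4 / 4"
    using G by simp_all
  note P = fps_sqrt_coeffs[OF PP[folded S_def] P0 S(1-3)]
  note Q = fps_sqrt_coeffs[OF QQ Q0 G(2,4,6)]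
  have P2: "fps_nth P 2 = of_real (1 / 8)"
    and P4: "fps_nth P 4 = of_real ((1 - 4 * a) / 96 - 1 / 128)"
    and P6: "fps_nth P 6 = of_real (((1 - b\<^sup>2 - 4 * a) * (1 - 4 * a) + b\<^sup>2) / 2880 - (1 - 4 * a) / 768 + 1 / 1024)"
    unfolding P(4-6) S G by (simp_all add: power2_eq_square power3_eq_cube field_simps)
  have Q2: "fps_nth Q 2 = of_real ((1 - 4 * a) / 24)"
    and Q4: "fps_nth Q 4 = of_real (((1 - b\<^sup>2 - 4 * a) * (1 - 4 * a) + b\<^sup>2) / 720 - (1 - 4 * a)\<^sup>2 / 1152)"
    unfolding Q(4,5) G by (simp_all add: power2_eq_square field_simps)
  have "(\<lambda>z. exp (- (1 / 2) * z) * (p z + 1 / 2 * (z * q z))) has_fps_expansion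
      fps_exp (- (1 / 2)) * (P + fps_const (1 / 2) * (fps_X * Q))"
    by (intro fps_expansion_intros p q)
  moreover have "(\<lambda>z. exp (- (1 / 2) * z) * (p z + 1 / 2 * (z * q z))) = norm_ext a b"
    by (simp add: fun_eq_iff norm_ext_def p_def q_def G_def)
  ultimately have expansion: "fps_expansion (norm_ext a b) 0 =
      fps_exp (- (1 / 2)) * (P + fps_const (1 / 2) * (fps_X * Q))"
    using fps_expansion_eqI by simp
  define T where "T = P + fps_const (1 / 2) * (fps_X * Q)"
  have T: "fps_nth T n = fps_nth P n + (if n = 0 then 0 else fps_nth Q (n - 1) / 2)" for n
    by (simp add: T_def)
  have coeff: "norm_coeff n a b = Re (\<Sum>i\<le>n. (- (1 / 2)) ^ i / fact i * fps_nth T (n - i))" for n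
    unfolding norm_coeff_def expansion T_def[symmetric] fps_mult_nth by (simp add: atLeast0AtMost)
  have sums: "(\<Sum>i\<le>2. f i) = f 0 + f 1 + f 2"
    "(\<Sum>i\<le>3. f i) = f 0 + f 1 + f 2 + f 3"
    "(\<Sum>i\<le>4. f i) = f 0 + f 1 + f 2 + f 3 + f 4"
    "(\<Sum>i\<le>5. f i) = f 0 + f 1 + f 2 + f 3 + f 4 + f 5"
    "(\<Sum>i\<le>6. f i) = f 0 + f 1 + f 2 + f 3 + f 4 + f 5 + f 6" for f :: "nat \<Rightarrow> complex"
    by (simp_all add: numeral_eq_Suc)
  note vals = T P0 Q0 P(1-3) Q(1-3) P2 P4 P6 Q2 Q4
  show "norm_coeff 0 a b = 1" by (simp add: coeff T P0)
  show "norm_coeff 1 a b = 0" by (simp add: coeff vals vals[unfolded One_nat_def])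
  show "norm_coeff 2 a b = 0"
    by (simp add: coeff sums vals vals[unfolded One_nat_def] fact_numeral power_divide field_simps)
  show "norm_coeff 3 a b = - (a / 12)"
    by (simp add: coeff sums vals vals[unfolded One_nat_def] fact_numeral power_divide field_simps)
  show "norm_coeff 4 a b = 0"
    by (simp add: coeff sums vals vals[unfolded One_nat_def] fact_numeral power_divide field_simps)
  show "norm_coeff 5 a b = 1 / 360 * a * b\<^sup>2 + 1 / 240 * a\<^sup>2 + 1 / 120 * a"
    by (simp add: coeff sums vals vals[unfolded One_nat_def] fact_numeral power_divide field_simps power2_eq_square)
  show "norm_coeff 6 a b = 1 / 288 * a\<^sup>2"
    by (simp add: coeff sums vals vals[unfolded One_nat_def] fact_numeral power_divide field_simps power2_eq_square)
qed
end

lemma eventually_short_time: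
  assumes "\<delta> > 0"
  shows "eventually (\<lambda>(a, b, t). a > 0 \<and> t > 0 \<and> bracket (A_ab a b) * t\<^sup>2 < \<delta>) short_time"
proof -
  have "eventually (\<lambda>x. 0 < x \<and> x < \<delta>) (at_right 0)"
    using assms eventually_at_right_less[of "0::real"] eventually_at_right_real[of 0 \<delta>] by (auto elim: eventually_mono)
  then show ?thesis
    unfolding short_time_def eventually_inf_principal
    by (auto simp: eventually_filtercomap case_prod_unfold elim: eventually_mono intro!: exI[of _ "\<lambda>x. 0 < x \<and> x < \<delta>"])
qed

text \<open>The threshold \<open>1/144\<close> for \<open>L t\<^sup>2\<close> says that \<open>t \<le> R/2\<close> with \<open>R = 1 / (6 \<surd>L)\<close>, and
  \<open>t (t/R)\<^sup>N = 6\<^sup>N L^(N/2) t^(N+1)\<close>.\<close>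

lemma norm_expansion_bigo:
  "(\<lambda>(a, b, t). op_norm (mat_exp ((- t) *\<^sub>R M_ab a b)) - (\<Sum>n\<le>N. norm_coeff n a b * t ^ n))
     \<in> O[short_time](\<lambda>(a, b, t). bracket (A_ab a b) powr (real N / 2) * t ^ Suc N)"
proof (rule bigoI[of _ "16 * 6 ^ N"])
  have "norm (op_norm (mat_exp ((- t) *\<^sub>R M_ab a b)) - (\<Sum>n\<le>N. norm_coeff n a b * t ^ n))
      \<le> 16 * 6 ^ N * norm (bracket (A_ab a b) powr (real N / 2) * t ^ Suc N)"
    if "a > 0" "t > 0" and small: "bracket (A_ab a b) * t\<^sup>2 < 1 / 144" for a b t :: real
  proof -
    define L where "L = bracket (A_ab a b)"
    have L: "1 \<le> L" unfolding L_def by (rule bracket_A_ab_bounds) fact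
    have "(sqrt L * t)\<^sup>2 \<le> (1 / 12)\<^sup>2"
      using small L by (simp add: power_mult_distrib power_divide L_def)
    then have "sqrt L * t \<le> 1 / 12" by (rule power2_le_imp_le) simp
    then have t: "t \<le> 1 / (6 * sqrt L) / 2" using L by (simp add: field_simps)
    have "L powr (real N / 2) = (L powr (1 / 2)) powr real N" by (simp add: powr_powr)
    also have "\<dots> = sqrt L ^ N" using L by (simp add: powr_half_sqrt powr_realpow)
    finally have powr: "L powr (real N / 2) = sqrt L ^ N" .
    have "\<bar>op_norm (mat_exp ((- t) *\<^sub>R M_ab a b)) - (\<Sum>n\<le>N. norm_coeff n a b * t ^ n)\<bar>
        \<le> 16 * t * (t / (1 / (6 * sqrt L))) ^ N"
      using norm_remainder[OF \<open>a > 0\<close> \<open>t > 0\<close> t[unfolded L_def]] by (simp add: L_def)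
    also have "\<dots> = 16 * 6 ^ N * (sqrt L ^ N * t ^ Suc N)"
      by (simp add: power_mult_distrib)
    also have "\<dots> = 16 * 6 ^ N * norm (L powr (real N / 2) * t ^ Suc N)"
      using \<open>t > 0\<close> L by (simp add: powr abs_mult)
    finally show ?thesis by (simp add: L_def)
  qed
  then show "eventually (\<lambda>x. norm (case x of (a, b, t) \<Rightarrow> op_norm (mat_exp ((- t) *\<^sub>R M_ab a b)) - (\<Sum>n\<le>N. norm_coeff n a b * t ^ n))
      \<le> 16 * 6 ^ N * norm (case x of (a, b, t) \<Rightarrow> bracket (A_ab a b) powr (real N / 2) * t ^ Suc N)) short_time"
    by (intro eventually_mono[OF eventually_short_time[of "1 / 144"]]) auto
qed

lemma eventually_pos_short_time: "eventually (\<lambda>(a, b, t). a > 0) short_time"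
  by (rule eventually_mono[OF eventually_short_time[of 1]]) auto

theorem proposition1p4:
  shows "\<exists>c :: nat \<Rightarrow> real \<Rightarrow> real \<Rightarrow> real.
    (\<forall>N. (\<lambda>(a, b, t). op_norm (mat_exp ((- t) *\<^sub>R M_ab a b)) - (\<Sum>n\<le>N. c n a b * t ^ n))
            \<in> O[short_time](\<lambda>(a, b, t). bracket (A_ab a b) powr (real N / 2) * t ^ Suc N)) \<and>
    (\<forall>a b. a > 0 \<longrightarrow>
       c 0 a b = 1 \<and> c 1 a b = 0 \<and> c 2 a b = 0 \<and> c 3 a b = - (a / 12) \<and> c 4 a b = 0 \<and>
       c 5 a b = 1 / 360 * a * b\<^sup>2 + 1 / 240 * a\<^sup>2 + 1 / 120 * a \<and>
       c 6 a b = 1 / 288 * a\<^sup>2) \<and>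
    (\<lambda>(a, b, t). op_norm (mat_exp ((- t) *\<^sub>R M_ab a b)) -
        (1 - a / 12 * t ^ 3 + (1 / 360 * a * b\<^sup>2 + 1 / 240 * a\<^sup>2 + 1 / 120 * a) * t ^ 5
           + 1 / 288 * a\<^sup>2 * t ^ 6))
      \<in> O[short_time](\<lambda>(a, b, t). bracket (A_ab a b) ^ 3 * t ^ 7)"
proof (intro exI[of _ norm_coeff] conjI allI impI norm_expansion_bigo norm_coeff_values)
  have sum6: "(\<Sum>n\<le>6. norm_coeff n a b * t ^ n) =
      1 - a / 12 * t ^ 3 + (1 / 360 * a * b\<^sup>2 + 1 / 240 * a\<^sup>2 + 1 / 120 * a) * t ^ 5 + 1 / 288 * a\<^sup>2 * t ^ 6"
    if "a > 0" for a b t :: real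
  proof -
    have "(\<Sum>n\<le>6. f n) = f 0 + f 1 + f 2 + f 3 + f 4 + f 5 + f 6" for f :: "nat \<Rightarrow> real"
      by (simp add: numeral_eq_Suc)
    then show ?thesis by (simp only: norm_coeff_values[OF that]) simp
  qed
  have powr: "bracket (A_ab a b) powr (real 6 / 2) = bracket (A_ab a b) ^ 3" if "a > 0" for a b
    using bracket_A_ab_bounds(1)[OF that, of b] by (simp add: powr_numeral)
  have eq: "eventually (\<lambda>x. (case x of (a, b, t) \<Rightarrow> op_norm (mat_exp ((- t) *\<^sub>R M_ab a b)) - (\<Sum>n\<le>6. norm_coeff n a b * t ^ n)) =
     (case x of (a, b, t) \<Rightarrow> op_norm (mat_exp ((- t) *\<^sub>R M_ab a b)) -
        (1 - a / 12 * t ^ 3 + (1 / 360 * a * b\<^sup>2 + 1 / 240 * a\<^sup>2 + 1 / 120 * a) * t ^ 5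
           + 1 / 288 * a\<^sup>2 * t ^ 6))) short_time"
    by (rule eventually_mono[OF eventually_pos_short_time]) (auto simp only: sum6 split: prod.splits)
  have eq': "eventually (\<lambda>x. (case x of (a, b, t) \<Rightarrow> bracket (A_ab a b) powr (real 6 / 2) * t ^ Suc 6) =
     (case x of (a, b, t) \<Rightarrow> bracket (A_ab a b) ^ 3 * t ^ 7)) short_time"
    by (rule eventually_mono[OF eventually_pos_short_time]) (clarsimp simp: powr[simplified])
  show "(\<lambda>(a, b, t). op_norm (mat_exp ((- t) *\<^sub>R M_ab a b)) -
        (1 - a / 12 * t ^ 3 + (1 / 360 * a * b\<^sup>2 + 1 / 240 * a\<^sup>2 + 1 / 120 * a) * t ^ 5
           + 1 / 288 * a\<^sup>2 * t ^ 6))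
      \<in> O[short_time](\<lambda>(a, b, t). bracket (A_ab a b) ^ 3 * t ^ 7)"
    using norm_expansion_bigo[of 6]
    unfolding landau_o.big.in_cong[OF eq] landau_o.big.cong[OF eq'] .
qed

end
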